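(* Suppose $\pi\in\mathfrak S_k$. (a) $\textsf{sup-mesh}(\pi)$ is minimized (among all permutations in $\mathfrak S_k$) if and only if $|\pi(i)-\pi(i+1)|=1$ for all $1\le i<k$; that is, if and only if $\pi=123\cdots k$ or $\pi=k\cdots321$. (b) $\textsf{sup-mesh}(\pi)$ is maximized (among all permutations in $\mathfrak S_k$) if and only if $|\pi(i)-\pi(i+1)|\neq1$ for all $1\le i<k$; that is, there are maximally many ($2k$) enclosed diagonals to avoid.
   Context: Permutations: $\mathfrak S_n$ is the set of permutations of $[n]=\{1,\ldots,n\}$, $n\ge 1$, written in one-line notation. The graph of $\pi\in\mathfrak S_k$ is $G(\pi)=\{(i,\pi(i)):1\le i\le k\}$. Classical patterns: an occurrence of $\pi\in\mathfrak S_k$ in $\sigma\in\mathfrak S_n$ is a choice of indices $i_1<\cdots<i_k$ in $[n]$ such that $\sigma(i_1)\cdots\sigma(i_k)$ is in the same relative order as $\pi(1)\cdots\pi(k)$. The permutation $\sigma$ contains $\pi$ if there is an occurrence of $\pi$ in $\sigma$, and avoids $\pi$ otherwise (in particular if $n<k$). Mesh patterns: a mesh pattern is a pair $(\pi,R)$ with $\pi\in\mathfrak S_k$ and $R\subseteq\{0,\ldots,k\}^2$ (the mesh); the element $(a,b)\in R$ represents the unit square $[a,a+1]\times[b,b+1]$. A permutation $\sigma\in\mathfrak S_n$ contains $(\pi,R)$ if there is an occurrence $i_1<\cdots<i_k$ of $\pi$ in $\sigma$ such that the following holds. Let $v_1<\cdots<v_k$ be the values $\sigma(i_1),\ldots,\sigma(i_k)$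 in increasing order, and set $i_0=v_0=0$, $i_{k+1}=v_{k+1}=n+1$. Then for every $(a,b)\in R$ there is no $t\in[n]$ with $i_a<t<i_{a+1}$ and $v_b<\sigma(t)<v_{b+1}$. Otherwise $\sigma$ avoids $(\pi,R)$. For a (classical or mesh) pattern $p$, $\mathrm{Av}(p)$ is the set of all permutations (of all sizes $n\ge1$) that avoid $p$. A mesh $R\subseteq\{0,\ldots,k\}^2$ is superfluous for $\pi\in\mathfrak S_k$ if $\mathrm{Av}((\pi,R))=\mathrm{Av}(\pi)$. $\textsf{sup-mesh}(\pi)$ denotes the number of meshes $R\subseteq\{0,\ldots,k\}^2$ that are superfluous for $\pi$. Enclosed diagonals: an enclosed diagonal of $(\pi,R)$ is a diagonal chain of $h\ge1$ squares of $R$, each meeting the next in a corner, such that the $h-1$ corners shared by successive squares all belong to $G(\pi)$, while the two extreme corners of the chain do not belong to $G(\pi)$. Explicitly, it is either an increasing chain of squares $(i+x,j+x)\in R$ for $0\le x<h$, with $(i+x,j+x)\in G(\pi)$ for $1\le x<h$ and $(i,j),(i+h,j+h)\notin G(\pi)$; or a decreasing chain of squares $(i+x,j-x)\in R$ for $0\le x<h$, with $(i+x,j+1-x)\in G(\pi)$ for $1\le x<h$ and $(i,j+1),(i+h,j+1-h)\notin G(\pi)$. For a mesh to be superfluous it is necessary and sufficient that there be no enclosed diagonals. In (b), "enclosed diagonals to avoid" refers to the chains with $h\ge2$ squares in $\{0,\ldots,k\}^2$ that satisfy the conditions on $G(\pi)$ above, i.e. that would be enclosed diagonals if all of their squares were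 in the mesh (squares with no corner in $G(\pi)$, the case $h=1$, being excluded from the mesh beforehand).
   Formalization: In (b), "maximized iff |π(i)−π(i+1)|≠1 for all i" is stated only for k≠2,3, since it fails there (every permutation in S_2 and S_3 has an adjacency, yet a maximizer exists); for all k, "maximized iff the number of enclosed diagonals to avoid is maximal" is stated. *)

theory Defs
  imports "HOL-Combinatorics.Permutations"
begin

text \<open>A permutation of size \<open>n\<close> is a function \<open>\<sigma>\<close> with \<open>\<sigma> permutes {1..n}\<close>. Such a function does not
  determine \<open>n\<close> (it is the identity outside \<open>{1..n}\<close>), so the size is always carried along.\<close>

definition perm_graph :: "nat \<Rightarrow> (nat \<Rightarrow> nat) \<Rightarrow> (nat \<times> nat) set" where
  "perm_graph k \<pi> = {(i, \<pi> i) | i. i \<in> {1..k}}"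

definition occurrence :: "nat \<Rightarrow> (nat \<Rightarrow> nat) \<Rightarrow> nat \<Rightarrow> (nat \<Rightarrow> nat) \<Rightarrow> (nat \<Rightarrow> nat) \<Rightarrow> bool" where
  "occurrence k \<pi> n \<sigma> i \<longleftrightarrow>
     strict_mono_on {1..k} i \<and> i ` {1..k} \<subseteq> {1..n} \<and>
     (\<forall>a\<in>{1..k}. \<forall>b\<in>{1..k}. \<sigma> (i a) < \<sigma> (i b) \<longleftrightarrow> \<pi> a < \<pi> b)"

definition contains :: "nat \<Rightarrow> (nat \<Rightarrow> nat) \<Rightarrow> nat \<Rightarrow> (nat \<Rightarrow> nat) \<Rightarrow> bool" where
  "contains k \<pi> n \<sigma> \<longleftrightarrow> (\<exists>i. occurrence k \<pi> n \<sigma> i)"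

text \<open>The conditions on \<open>v\<close> below say that \<open>v 1 < \<dots> < v k\<close> are the values of the occurrence in
  increasing order, with the boundary conventions at \<open>0\<close> and \<open>k + 1\<close>.\<close>

definition mesh_contains ::
    "nat \<Rightarrow> (nat \<Rightarrow> nat) \<Rightarrow> (nat \<times> nat) set \<Rightarrow> nat \<Rightarrow> (nat \<Rightarrow> nat) \<Rightarrow> bool" where
  "mesh_contains k \<pi> R n \<sigma> \<longleftrightarrow>
     (\<exists>i v. occurrence k \<pi> n \<sigma> i \<and>
        strict_mono_on {1..k} v \<and> v ` {1..k} = \<sigma> ` i ` {1..k} \<and>
        i 0 = 0 \<and> v 0 = 0 \<and> i (k + 1) = n + 1 \<and> v (k + 1) = n + 1 \<and>
        (\<forall>(a, b)\<in>R. \<not> (\<exists>t\<in>{1..n}. i a < t \<and> t < i (a + 1) \<and> v b < \<sigma> t \<and> \<sigma> t < v (b + 1))))"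

definition Av :: "nat \<Rightarrow> (nat \<Rightarrow> nat) \<Rightarrow> (nat \<times> (nat \<Rightarrow> nat)) set" where
  "Av k \<pi> = {(n, \<sigma>). 1 \<le> n \<and> \<sigma> permutes {1..n} \<and> \<not> contains k \<pi> n \<sigma>}"

definition mesh_Av :: "nat \<Rightarrow> (nat \<Rightarrow> nat) \<Rightarrow> (nat \<times> nat) set \<Rightarrow> (nat \<times> (nat \<Rightarrow> nat)) set" where
  "mesh_Av k \<pi> R = {(n, \<sigma>). 1 \<le> n \<and> \<sigma> permutes {1..n} \<and> \<not> mesh_contains k \<pi> R n \<sigma>}"

definition superfluous :: "nat \<Rightarrow> (nat \<Rightarrow> nat) \<Rightarrow> (nat \<times> nat) set \<Rightarrow> bool" where
  "superfluous k \<pi> R \<longleftrightarrow> mesh_Av k \<pi> R = Av k \<pi>"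

definition sup_mesh :: "nat \<Rightarrow> (nat \<Rightarrow> nat) \<Rightarrow> nat" where
  "sup_mesh k \<pi> = card {R. R \<subseteq> {0..k} \<times> {0..k} \<and> superfluous k \<pi> R}"

text \<open>A chain of \<open>h\<close> squares is represented by its set of squares; as \<open>h \<ge> 2\<close> in what is counted
  below, this set determines the starting square, the length and the direction. In a
  decreasing chain, \<open>x \<le> j\<close> keeps the subtractions on \<open>nat\<close> from truncating (note that
  \<open>h \<le> j + 1\<close> follows).\<close>

definition increasing_chain :: "nat \<Rightarrow> (nat \<Rightarrow> nat) \<Rightarrow> nat \<Rightarrow> nat \<Rightarrow> nat \<Rightarrow> bool" where
  "increasing_chain k \<pi> i j h \<longleftrightarrow>
     (\<forall>x<h. (i + x, j + x) \<in> {0..k} \<times> {0..k}) \<and>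
     (\<forall>x. 1 \<le> x \<and> x < h \<longrightarrow> (i + x, j + x) \<in> perm_graph k \<pi>) \<and>
     (i, j) \<notin> perm_graph k \<pi> \<and> (i + h, j + h) \<notin> perm_graph k \<pi>"

definition decreasing_chain :: "nat \<Rightarrow> (nat \<Rightarrow> nat) \<Rightarrow> nat \<Rightarrow> nat \<Rightarrow> nat \<Rightarrow> bool" where
  "decreasing_chain k \<pi> i j h \<longleftrightarrow>
     (\<forall>x<h. x \<le> j \<and> (i + x, j - x) \<in> {0..k} \<times> {0..k}) \<and>
     (\<forall>x. 1 \<le> x \<and> x < h \<longrightarrow> (i + x, j + 1 - x) \<in> perm_graph k \<pi>) \<and>
     (i, j + 1) \<notin> perm_graph k \<pi> \<and> (i + h, j + 1 - h) \<notin> perm_graph k \<pi>"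

definition diagonals_to_avoid :: "nat \<Rightarrow> (nat \<Rightarrow> nat) \<Rightarrow> (nat \<times> nat) set set" where
  "diagonals_to_avoid k \<pi> =
     {(\<lambda>x. (i + x, j + x)) ` {..<h} | i j h. 2 \<le> h \<and> increasing_chain k \<pi> i j h} \<union>
     {(\<lambda>x. (i + x, j - x)) ` {..<h} | i j h. 2 \<le> h \<and> decreasing_chain k \<pi> i j h}"

end

theory Submission
  imports Defs Complex_Main
begin

text \<open>Call two squares linked if they meet in a corner belonging to \<open>G(\<pi>)\<close>. A mesh is superfluous iff it
  contains no nonempty union of link components: a full component cannot be emptied, since the
  permutation obtained by inserting one extra point into it has all its occurrences of \<open>\<pi>\<close> leaving
  their extra point in that component; and if every component has a square outside the mesh, then an
  occurrence can be pushed towards these holes until the mesh is empty.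

  The components are the diagonals to avoid and the squares without a corner in \<open>G(\<pi>)\<close>, so
  \<open>sup_mesh\<close> is the product of \<open>2 ^ h - 1\<close> over the diagonals, \<open>h\<close> being their lengths. Cutting
  \<open>\<pi>\<close> into maximal runs of consecutive entries differing by one in a fixed direction and telescoping
  over each run turns this into \<open>\<Prod>i. 3 * weight (r i)\<close>, where \<open>r i\<close> is the rank of \<open>i\<close> in its run
  and \<open>weight a = (2 ^ (a + 1) - 1) / (2 ^ a - 1)\<close> is strictly decreasing. As \<open>1 \<le> r i \<le> i\<close>,
  the extremal cases are a single run and runs of length one. The latter are impossible precisely for
  \<open>k = 2\<close> and \<open>k = 3\<close>, where the values are computed outright.\<close>

section \<open>Superfluous meshes and closed sets of squares\<close>

text \<open>Unions of link components. A square is named by its south-west corner.\<close>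

definition corner_closed :: "nat \<Rightarrow> (nat \<Rightarrow> nat) \<Rightarrow> (nat \<times> nat) set \<Rightarrow> bool" where
  "corner_closed k \<pi> C \<longleftrightarrow> (\<forall>c\<in>{1..k}.
     ((c - 1, \<pi> c - 1) \<in> C \<longleftrightarrow> (c, \<pi> c) \<in> C) \<and> ((c - 1, \<pi> c) \<in> C \<longleftrightarrow> (c, \<pi> c - 1) \<in> C))"

section \<open>Order embeddings that omit one index\<close>

definition lift :: "nat \<Rightarrow> nat \<Rightarrow> nat" where
  "lift q x = (if x < q then x else Suc x)"

lemma lift_less_iff [simp]: "lift q x < lift q y \<longleftrightarrow> x < y"
  by (auto simp: lift_def)

lemma lift_image: "q \<in> {1..k+1} \<Longrightarrow> lift q ` {1..k} = {1..k+1} - {q}"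
proof (intro equalityI subsetI)
  fix y assume q: "q \<in> {1..k+1}" and y: "y \<in> {1..k+1} - {q}"
  show "y \<in> lift q ` {1..k}"
  proof (cases "y < q")
    case True
    then show ?thesis using q y by (intro image_eqI[of _ _ y]) (auto simp: lift_def)
  next
    case False
    then show ?thesis using q y by (intro image_eqI[of _ _ "y - 1"]) (auto simp: lift_def)
  qed
qed (auto simp: lift_def split: if_splits)

text \<open>Places the omitted index \<open>q\<close> strictly inside the gap numbered
  \<open>q - 1\<close> of the mesh condition; the prescribed values at \<open>0\<close> and
  \<open>k + 1\<close> serve the two extreme gaps. It is applied both to positions and to
  values.\<close>

lemma lift_gap:
  assumes q: "q \<in> {1..k+1}" and i: "\<And>x. x \<in> {1..k} \<Longrightarrow> i x = lift q x"
    and bd: "i 0 = 0" "i (k + 1) = k + 2"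
  shows "i (q - 1) < q" "q < i q"
proof -
  show "i (q - 1) < q"
  proof (cases "q = 1")
    case False
    then have "q - 1 \<in> {1..k}"
      using q by auto
    then show ?thesis using q i[of "q - 1"] by (simp add: lift_def)
  qed (use bd in simp)
  show "q < i q"
  proof (cases "q = k + 1")
    case False
    then show ?thesis using q i[of q] by (simp add: lift_def)
  qed (use bd in simp)
qed

text \<open>An increasing function on \<open>{1..k}\<close> lists its image in sorted order, and a
  finite set has only one sorted list without repetitions.\<close>

lemma strict_mono_on_unique:
  fixes f g :: "nat \<Rightarrow> nat"
  assumes f: "strict_mono_on {1..k} f" and g: "strict_mono_on {1..k} g"
    and eq: "f ` {1..k} = g ` {1..k}" and x: "x \<in> {1..k}"
  shows "f x = g x"
proof -
  have *: "sorted (map h [1..<Suc k]) \<and> distinct (map h [1..<Suc k])"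
    if h: "strict_mono_on {1..k} h" for h :: "nat \<Rightarrow> nat"
  proof -
    have "inj_on h {1..k}"
      by (rule strict_mono_on_imp_inj_on[OF h])
    moreover have "set [1..<Suc k] = {1..k}"
      by auto
    moreover have "sorted (map h [1..<Suc k])"
      unfolding sorted_iff_nth_mono
      using strict_mono_on_leD[OF h] by (auto simp del: upt_Suc)
    ultimately show ?thesis
      by (simp add: distinct_map del: upt_Suc)
  qed
  have "set [1..<Suc k] = {1..k}"
    by auto
  then have "set (map f [1..<Suc k]) = set (map g [1..<Suc k])"
    using eq by (simp del: upt_Suc)
  then have "map f [1..<Suc k] = map g [1..<Suc k]"
    using *[OF f] *[OF g] sorted_distinct_set_unique by blast
  then show ?thesis
    using x by (auto simp del: upt_Suc)
qed

lemma strict_mono_on_eq_lift: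
  assumes i: "strict_mono_on {1..k} i" and sub: "i ` {1..k} \<subseteq> {1..k+1}"
  obtains q where "q \<in> {1..k+1}" "\<And>x. x \<in> {1..k} \<Longrightarrow> i x = lift q x"
    "i ` {1..k} = {1..k+1} - {q}"
proof -
  have "card (i ` {1..k}) = k"
    using strict_mono_on_imp_inj_on[OF i] by (simp add: card_image del: One_nat_def)
  then have "card ({1..k+1} - i ` {1..k}) = 1"
    using sub by (subst card_Diff_subset) auto
  then obtain q where q: "{1..k+1} - i ` {1..k} = {q}"
    by (auto simp: card_1_singleton_iff)
  have q1: "q \<in> {1..k+1}" and im: "i ` {1..k} = {1..k+1} - {q}"
    using q sub by blast+
  have "strict_mono_on {1..k} (lift q)"
    by (simp add: strict_mono_on_def)
  then have "i x = lift q x" if "x \<in> {1..k}" for x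
    using strict_mono_on_unique[OF i _ _ that] im lift_image[OF q1] by metis
  then show ?thesis
    using that q1 im by blast
qed

text \<open>Provides the increasing enumeration \<open>v\<close> of the mesh condition: the value of
  rank \<open>b\<close> sits where \<open>\<pi>\<close> takes the value \<open>b\<close>.\<close>

lemma occurrence_values:
  assumes \<pi>: "\<pi> permutes {1..k}" and occ: "occurrence k \<pi> n \<sigma> i"
  shows "strict_mono_on {1..k} (\<lambda>b. \<sigma> (i (inv \<pi> b)))"
    and "(\<lambda>b. \<sigma> (i (inv \<pi> b))) ` {1..k} = \<sigma> ` i ` {1..k}"
proof -
  have inv: "inv \<pi> ` {1..k} = {1..k}"
    using permutes_inv[OF \<pi>] by (rule permutes_image)
  have "(\<lambda>b. \<sigma> (i (inv \<pi> b))) ` {1..k} = (\<lambda>a. \<sigma> (i a)) ` (inv \<pi> ` {1..k})"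
    by (rule image_image[symmetric])
  then show "(\<lambda>b. \<sigma> (i (inv \<pi> b))) ` {1..k} = \<sigma> ` i ` {1..k}"
    by (simp add: inv image_image del: One_nat_def)
  show "strict_mono_on {1..k} (\<lambda>b. \<sigma> (i (inv \<pi> b)))"
  proof (rule strict_mono_onI)
    fix r s assume "r \<in> {1..k}" "s \<in> {1..k}" "r < s"
    moreover have "inv \<pi> r \<in> {1..k}" "inv \<pi> s \<in> {1..k}"
      using inv calculation by blast+
    ultimately show "\<sigma> (i (inv \<pi> r)) < \<sigma> (i (inv \<pi> s))"
      using occ unfolding occurrence_def by (simp add: permutes_inverses[OF \<pi>])
  qed
qed

section \<open>Closed sets of squares as obstructions\<close>

lemma superfluous_iff:
  "superfluous k \<pi> R \<longleftrightarrow>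
     (\<forall>n \<sigma>. 1 \<le> n \<and> \<sigma> permutes {1..n} \<and> contains k \<pi> n \<sigma> \<longrightarrow> mesh_contains k \<pi> R n \<sigma>)"
proof -
  have "mesh_contains k \<pi> R n \<sigma> \<Longrightarrow> contains k \<pi> n \<sigma>" for n \<sigma>
    by (auto simp: mesh_contains_def contains_def)
  then show ?thesis
    by (auto simp: superfluous_def mesh_Av_def Av_def set_eq_iff)
qed

text \<open>If deleting position \<open>p\<close> and deleting position \<open>q\<close> from \<open>\<sigma>\<close> both leave \<open>\<pi>\<close>, then the entries of
  \<open>\<sigma>\<close> at \<open>p, \<dots>, q\<close> are consecutive and monotone, so that the squares of \<open>\<pi>\<close> holding the two
  deleted points are joined by a diagonal through points of \<open>\<pi>\<close>.\<close>

lemma corner_closed_walk: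
  assumes C: "corner_closed k \<pi> C" and start: "(p - 1, u - 1) \<in> C" and inj: "inj \<sigma>"
    and p: "1 \<le> p" "p \<le> q" "q \<le> k + 1" and u: "1 \<le> u" "1 \<le> w"
    and \<sigma>: "\<sigma> p = u" "\<sigma> q = w"
    and dp: "\<And>x. x \<in> {1..k} \<Longrightarrow> \<sigma> (lift p x) = lift u (\<pi> x)"
    and dq: "\<And>x. x \<in> {1..k} \<Longrightarrow> \<sigma> (lift q x) = lift w (\<pi> x)"
  shows "(q - 1, w - 1) \<in> C"
proof (cases "u \<le> w")
  case True
  \<comment> \<open>Positions before \<open>q\<close> are unmoved by \<open>lift q\<close>, so
    \<open>dq\<close> yields the value of \<open>\<pi>\<close> there; positions from
    \<open>p\<close> on are shifted by \<open>lift p\<close>, so \<open>dp\<close> turns this value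
    into the next entry of \<open>\<sigma>\<close>. The point of \<open>\<pi>\<close> met in between
    links the two squares.\<close>
  have "\<sigma> (p + x) = u + x \<and> u + x \<le> w \<and> (p - 1 + x, u - 1 + x) \<in> C" if "p + x \<le> q" for x
    using that
  proof (induction x)
    case 0
    then show ?case using start \<sigma> True by simp
  next
    case (Suc x)
    let ?t = "p + x"
    have t: "?t \<in> {1..k}" "?t < q"
      using Suc.prems p by auto
    have IH: "\<sigma> ?t = u + x" "u + x \<le> w" "(p - 1 + x, u - 1 + x) \<in> C"
      using Suc by auto
    have "u + x \<noteq> w"
      using IH \<sigma> t inj by (metis injD less_irrefl)
    moreover have "lift w (\<pi> ?t) = u + x"
      using dq[OF t(1)] t IH by (simp add: lift_def)
    ultimately have pi: "\<pi> ?t = u + x"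
      using IH by (auto simp: lift_def split: if_splits)
    have "\<sigma> (Suc ?t) = Suc (u + x)"
      using dp[OF t(1)] pi by (simp add: lift_def)
    moreover have "p - 1 + x = ?t - 1" "u - 1 + x = \<pi> ?t - 1"
      using p u pi by auto
    then have "(?t, \<pi> ?t) \<in> C"
      using C t(1) IH(3) unfolding corner_closed_def by metis
    ultimately show ?case
      using pi p u IH(2) \<open>u + x \<noteq> w\<close> by simp
  qed
  from this[of "q - p"] show ?thesis
    using p u \<sigma> by simp
next
  case False
  \<comment> \<open>Before \<open>q\<close> is reached the current entry exceeds \<open>w\<close>,
    so \<open>dq\<close> makes the value of \<open>\<pi>\<close> one smaller, and \<open>dp\<close>
    hands it on unchanged. The additive form of the equations avoids truncated subtraction.\<close>
  have "\<sigma> (p + x) + x = u \<and> w + x \<le> u \<and> (p - 1 + x, u - 1 - x) \<in> C" if "p + x \<le> q" for x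
    using that
  proof (induction x)
    case 0
    then show ?case using start \<sigma> False by simp
  next
    case (Suc x)
    let ?t = "p + x"
    have t: "?t \<in> {1..k}" "?t < q"
      using Suc.prems p by auto
    have IH: "\<sigma> ?t + x = u" "w + x \<le> u" "(p - 1 + x, u - 1 - x) \<in> C"
      using Suc by auto
    have "w + x \<noteq> u"
      using IH \<sigma> t inj by (metis add_right_cancel injD less_irrefl)
    moreover have "lift w (\<pi> ?t) + x = u"
      using dq[OF t(1)] t IH by (simp add: lift_def)
    ultimately have pi: "\<pi> ?t + Suc x = u"
      using IH by (auto simp: lift_def split: if_splits)
    have "\<sigma> (Suc ?t) + Suc x = u"
      using dp[OF t(1)] pi by (simp add: lift_def)
    moreover have "p - 1 + x = ?t - 1" "u - 1 - x = \<pi> ?t"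
      using p pi by auto
    then have "(?t, \<pi> ?t - 1) \<in> C"
      using C t(1) IH(3) unfolding corner_closed_def by metis
    moreover have "\<pi> ?t - 1 = u - 1 - Suc x"
      using pi by simp
    ultimately show ?case
      using pi p u IH(2) \<open>w + x \<noteq> u\<close> by simp
  qed
  from this[of "q - p"] have *: "w + (q - p) = u" "(q - 1, u - 1 - (q - p)) \<in> C"
    using p \<sigma> by simp_all
  moreover have "u - 1 - (q - p) = w - 1"
    using *(1) by simp
  ultimately show ?thesis
    by simp
qed

lemma corner_closed_Compl: "corner_closed k \<pi> C \<Longrightarrow> corner_closed k \<pi> (- C)"
  by (simp add: corner_closed_def)

text \<open>The map \<open>g\<close> carries \<open>\<pi>\<close> over to the remaining positions
  and values along the two skipping bijections; sending \<open>p\<close> to \<open>u\<close>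
  completes it.\<close>

lemma exists_insertion:
  assumes \<pi>: "\<pi> permutes {1..k}" and p: "p \<in> {1..k+1}" and u: "u \<in> {1..k+1}"
  obtains \<sigma> where "\<sigma> permutes {1..k+1}" "\<sigma> p = u" "\<And>x. x \<in> {1..k} \<Longrightarrow> \<sigma> (lift p x) = lift u (\<pi> x)"
proof -
  have "inj_on (lift q) A" for q A
    by (rule linorder_inj_onI) (auto simp: lift_def)
  then have bl: "bij_betw (lift q) {1..k} ({1..k+1} - {q})" if "q \<in> {1..k+1}" for q
    using lift_image[OF that] by (simp add: bij_betw_def)
  define g where "g = (\<lambda>y. lift u (\<pi> (inv_into {1..k} (lift p) y)))"
  have b: "bij_betw g ({1..k+1} - {p}) ({1..k+1} - {u})"
    using bij_betw_trans[OF bij_betw_trans[OF bij_betw_inv_into[OF bl[OF p]]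
        permutes_imp_bij[OF \<pi>]] bl[OF u]]
    by (simp add: g_def comp_def)
  define \<sigma> where "\<sigma> = (\<lambda>y. if y = p then u else if y \<in> {1..k+1} then g y else y)"
  have "bij_betw \<sigma> ({1..k+1} - {p}) ({1..k+1} - {u})"
    using b by (rule bij_betw_cong[THEN iffD1, rotated]) (auto simp: \<sigma>_def)
  moreover have "bij_betw \<sigma> {p} {u}"
    by (simp add: \<sigma>_def)
  ultimately have "bij_betw \<sigma> ({p} \<union> ({1..k+1} - {p})) ({u} \<union> ({1..k+1} - {u}))"
    by (intro bij_betw_combine) auto
  moreover have "{p} \<union> ({1..k+1} - {p}) = {1..k+1}" "{u} \<union> ({1..k+1} - {u}) = {1..k+1}"
    using p u by blast+
  ultimately have "bij_betw \<sigma> {1..k+1} {1..k+1}"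
    by simp
  then have perm: "\<sigma> permutes {1..k+1}"
    by (rule bij_imp_permutes) (use p in \<open>auto simp: \<sigma>_def\<close>)
  have "\<sigma> (lift p x) = lift u (\<pi> x)" if x: "x \<in> {1..k}" for x
  proof -
    have "lift p x \<in> {1..k+1} - {p}"
      using x lift_image[OF p] by blast
    then show ?thesis
      using x inv_into_f_f[OF bij_betw_imp_inj_on[OF bl[OF p]] x]
      by (auto simp: \<sigma>_def g_def)
  qed
  then show ?thesis
    using that perm by (auto simp: \<sigma>_def)
qed

text \<open>Insert a point into a square of \<open>C\<close>. Each occurrence of
  \<open>\<pi>\<close> in the result omits a single point, whose deletion leaves
  \<open>\<pi>\<close> as well; by the walk that point occupies a square of \<open>C\<close>, hence
  one of the mesh.\<close>

lemma not_superfluous_if_corner_closed: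
  assumes \<pi>: "\<pi> permutes {1..k}" and R: "R \<subseteq> {0..k} \<times> {0..k}"
    and C: "corner_closed k \<pi> C" "C \<noteq> {}" "C \<subseteq> R"
  shows "\<not> superfluous k \<pi> R"
proof
  assume sup: "superfluous k \<pi> R"
  obtain a b where ab: "(a, b) \<in> C" "a \<le> k" "b \<le> k"
    using C R by fastforce
  \<comment> \<open>A point inserted into the square with south-west corner \<open>(a, b)\<close>
    comes just after the first \<open>a\<close> positions and the lowest \<open>b\<close>
    values.\<close>
  define p u where "p = a + 1" and "u = b + 1"
  have p: "p \<in> {1..k+1}" and u: "u \<in> {1..k+1}"
    using ab by (auto simp: p_def u_def)
  obtain \<sigma> where \<sigma>: "\<sigma> permutes {1..k+1}" "\<sigma> p = u"
    and dp: "\<And>x. x \<in> {1..k} \<Longrightarrow> \<sigma> (lift p x) = lift u (\<pi> x)"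
    using exists_insertion[OF \<pi> p u] by blast
  have "occurrence k \<pi> (k + 1) \<sigma> (lift p)"
    using lift_image[OF p] dp by (auto simp: occurrence_def strict_mono_on_def)
  then have "contains k \<pi> (k + 1) \<sigma>"
    by (auto simp: contains_def)
  then have "mesh_contains k \<pi> R (k + 1) \<sigma>"
    using sup \<sigma>(1) unfolding superfluous_iff by simp
  then obtain i v where occ: "occurrence k \<pi> (k + 1) \<sigma> i" and v: "strict_mono_on {1..k} v"
    and vi: "v ` {1..k} = \<sigma> ` i ` {1..k}"
    and bd: "i 0 = 0" "v 0 = 0" "i (k + 1) = k + 1 + 1" "v (k + 1) = k + 1 + 1"
    and mesh: "\<forall>(a, b)\<in>R. \<not> (\<exists>t\<in>{1..k+1}. i a < t \<and> t < i (a + 1) \<and> v b < \<sigma> t \<and> \<sigma> t < v (b + 1))"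
    unfolding mesh_contains_def by blast
  obtain q where q: "q \<in> {1..k+1}" and iq: "\<And>x. x \<in> {1..k} \<Longrightarrow> i x = lift q x"
    and imq: "i ` {1..k} = {1..k+1} - {q}"
    using strict_mono_on_eq_lift[of k i] occ unfolding occurrence_def by metis
  define w where "w = \<sigma> q"
  have w: "w \<in> {1..k+1}"
    using permutes_in_image[OF \<sigma>(1)] q by (simp add: w_def)
  have imw: "\<sigma> ` i ` {1..k} = {1..k+1} - {w}"
    unfolding imq w_def
    by (simp add: image_set_diff[OF permutes_inj[OF \<sigma>(1)]] permutes_image[OF \<sigma>(1)]
        del: One_nat_def)
  have smw: "strict_mono_on {1..k} (lift w)"
    by (simp add: strict_mono_on_def)
  have vw: "v x = lift w x" if "x \<in> {1..k}" for x
    by (rule strict_mono_on_unique[OF v smw _ that]) (simp only: vi imw lift_image[OF w])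
  have dq: "\<sigma> (lift q x) = lift w (\<pi> x)" if x: "x \<in> {1..k}" for x
  proof -
    have px: "\<pi> x \<in> {1..k}"
      using permutes_in_image[OF \<pi>] x by blast
    have "\<sigma> (i (inv \<pi> (\<pi> x))) = lift w (\<pi> x)"
      using occurrence_values[OF \<pi> occ] lift_image[OF w] imw
      by (intro strict_mono_on_unique[OF _ smw _ px]) auto
    then show ?thesis
      using iq[OF x] by (simp add: permutes_inverses[OF \<pi>])
  qed
  have start: "(p - 1, u - 1) \<in> C"
    using ab by (simp add: p_def u_def)
  have "(q - 1, w - 1) \<in> C"
  proof (cases "p \<le> q")
    case True
    show ?thesis
      by (rule corner_closed_walk[OF C(1) start permutes_inj[OF \<sigma>(1)] _ True _ _ _ \<sigma>(2)
            w_def[symmetric] dp dq])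
        (use p q u w in simp_all)
  next
    case False
    then have "q \<le> p"
      by simp
    \<comment> \<open>The walk only leads to the right, so here it goes from \<open>q\<close> to
      \<open>p\<close>, inside the complement of \<open>C\<close>, which is closed too.\<close>
    have "(p - 1, u - 1) \<in> - C" if "(q - 1, w - 1) \<in> - C"
      by (rule corner_closed_walk[OF corner_closed_Compl[OF C(1)] that permutes_inj[OF \<sigma>(1)] _
            \<open>q \<le> p\<close> _ _ _ w_def[symmetric] \<sigma>(2) dq dp])
        (use p q u w in simp_all)
    then show ?thesis
      using start by blast
  qed
  then have "(q - 1, w - 1) \<in> R"
    using C(3) by blast
  then have "\<not> (i (q - 1) < q \<and> q < i (q - 1 + 1) \<and> v (w - 1) < \<sigma> q \<and> \<sigma> q < v (w - 1 + 1))"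
    using mesh q by blast
  moreover have "q - 1 + 1 = q" "w - 1 + 1 = w"
    using q w by auto
  moreover have "i (q - 1) < q" "q < i q"
    using lift_gap[OF q iq] bd by simp_all
  moreover have "v (w - 1) < w" "w < v w"
    using lift_gap[OF w vw] bd by simp_all
  ultimately show False
    by (simp add: w_def)
qed

section \<open>Pushing an occurrence into the holes of a mesh\<close>

lemma occurrence_fun_upd:
  assumes occ: "occurrence k \<pi> n \<sigma> i" and \<pi>: "\<pi> permutes {1..k}" and c: "c \<in> {1..k}" and t: "t \<in> {1..n}"
    and pos: "\<And>d. d \<in> {1..k} \<Longrightarrow> d < c \<Longrightarrow> i d < t" "\<And>d. d \<in> {1..k} \<Longrightarrow> c < d \<Longrightarrow> t < i d"
    and val: "\<And>d. d \<in> {1..k} \<Longrightarrow> \<pi> d < \<pi> c \<Longrightarrow> \<sigma> (i d) < \<sigma> t"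
      "\<And>d. d \<in> {1..k} \<Longrightarrow> \<pi> c < \<pi> d \<Longrightarrow> \<sigma> t < \<sigma> (i d)"
  shows "occurrence k \<pi> n \<sigma> (i(c := t))"
proof -
  have mono: "strict_mono_on {1..k} i" and sub: "i ` {1..k} \<subseteq> {1..n}"
    and iff: "\<And>a b. a \<in> {1..k} \<Longrightarrow> b \<in> {1..k} \<Longrightarrow> \<sigma> (i a) < \<sigma> (i b) \<longleftrightarrow> \<pi> a < \<pi> b"
    using occ unfolding occurrence_def by blast+
  have "strict_mono_on {1..k} (i(c := t))"
    using mono pos by (auto simp: strict_mono_on_def)
  moreover have "(i(c := t)) ` {1..k} \<subseteq> {1..n}"
    using sub t by auto
  moreover have "\<sigma> ((i(c := t)) a) < \<sigma> ((i(c := t)) b) \<longleftrightarrow> \<pi> a < \<pi> b"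
    if a: "a \<in> {1..k}" and b: "b \<in> {1..k}" for a b
  proof -
    have ne: "\<pi> d < \<pi> c \<or> \<pi> c < \<pi> d" if "d \<noteq> c" for d
      using permutes_inj[OF \<pi>] that by (metis injD linorder_neqE_nat)
    show ?thesis
      using iff[OF a b] ne[of a] ne[of b] val[OF a] val[OF b] by auto
  qed
  ultimately show ?thesis
    unfolding occurrence_def by blast
qed

text \<open>Choose for every point of \<open>\<pi>\<close> one of its two squares on each diagonal: \<open>up c\<close> selects the
  north-east over the south-west square of \<open>(c, \<pi> c)\<close>, and \<open>left c\<close> the north-west over the
  south-east one. The two selected squares lie on a common side of the point, so pushing an entry of an
  occurrence into one of them always increases the same coordinate, up to sign. An occurrence
  maximising the sum of these signed coordinates leaves every selected square empty.\<close>

lemma superfluous_if_selected: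
  assumes \<pi>: "\<pi> permutes {1..k}" and R: "R \<subseteq> {0..k} \<times> {0..k}"
    and sel: "\<And>a b. (a, b) \<in> R \<Longrightarrow> \<exists>c\<in>{1..k}.
      (c = a \<and> \<pi> c = b \<and> up c) \<or> (c = a + 1 \<and> \<pi> c = b + 1 \<and> \<not> up c) \<or>
      (c = a + 1 \<and> \<pi> c = b \<and> left c) \<or> (c = a \<and> \<pi> c = b + 1 \<and> \<not> left c)"
  shows "superfluous k \<pi> R"
  unfolding superfluous_iff
proof (intro allI impI, elim conjE)
  fix n \<sigma>
  assume n: "1 \<le> n" and \<sigma>: "\<sigma> permutes {1..n}" and con: "contains k \<pi> n \<sigma>"
  \<comment> \<open>The four cases are the common side of the two selected squares: north, east,
    west and south. Subtracting from \<open>n\<close> makes the last two quantities to be increased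
    as well; nothing truncates, all coordinates being at most \<open>n\<close>.\<close>
  define \<phi> where "\<phi> = (\<lambda>c t. if up c then (if left c then \<sigma> t else t)
    else if left c then n - t else n - \<sigma> t)"
  define \<Phi> where "\<Phi> = (\<lambda>i. \<Sum>c\<in>{1..k}. \<phi> c (i c))"
  have \<sigma>n: "\<sigma> t \<in> {1..n}" if "t \<in> {1..n}" for t
    using permutes_in_image[OF \<sigma>] that by blast
  have \<phi>_le: "\<phi> c t \<le> n" if "t \<in> {1..n}" for c t
    using \<sigma>n[OF that] that by (auto simp: \<phi>_def)
  obtain i0 where i0: "occurrence k \<pi> n \<sigma> i0"
    using con by (auto simp: contains_def)
  have "\<Phi> i \<le> k * n" if "occurrence k \<pi> n \<sigma> i" for i
  proof -
    have "\<Phi> i \<le> (\<Sum>c\<in>{1..k}. n)"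
      unfolding \<Phi>_def using that
      by (intro sum_mono \<phi>_le) (auto simp: occurrence_def simp del: atLeastAtMost_iff)
    then show ?thesis by simp
  qed
  then have "\<exists>i. occurrence k \<pi> n \<sigma> i \<and> (\<forall>j. occurrence k \<pi> n \<sigma> j \<longrightarrow> \<Phi> j \<le> \<Phi> i)"
    using ex_has_greatest_nat[where P = "occurrence k \<pi> n \<sigma>" and k = i0 and f = \<Phi> and b = "Suc (k * n)"] i0
    by (simp add: less_Suc_eq_le)
  then obtain i where occ: "occurrence k \<pi> n \<sigma> i"
    and max: "\<And>j. occurrence k \<pi> n \<sigma> j \<Longrightarrow> \<Phi> j \<le> \<Phi> i"
    by (elim exE conjE) simp
  have mono: "strict_mono_on {1..k} i" and sub: "i ` {1..k} \<subseteq> {1..n}"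
    and iff: "\<And>a b. a \<in> {1..k} \<Longrightarrow> b \<in> {1..k} \<Longrightarrow> \<sigma> (i a) < \<sigma> (i b) \<longleftrightarrow> \<pi> a < \<pi> b"
    using occ unfolding occurrence_def by blast+
  have push: False
    if c: "c \<in> {1..k}" and t: "t \<in> {1..n}"
      and gt: "\<phi> c (i c) < \<phi> c t"
      and "\<And>d. d \<in> {1..k} \<Longrightarrow> d < c \<Longrightarrow> i d < t" "\<And>d. d \<in> {1..k} \<Longrightarrow> c < d \<Longrightarrow> t < i d"
      and "\<And>d. d \<in> {1..k} \<Longrightarrow> \<pi> d < \<pi> c \<Longrightarrow> \<sigma> (i d) < \<sigma> t"
      and "\<And>d. d \<in> {1..k} \<Longrightarrow> \<pi> c < \<pi> d \<Longrightarrow> \<sigma> t < \<sigma> (i d)" for c t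
  proof -
    have "occurrence k \<pi> n \<sigma> (i(c := t))"
      by (rule occurrence_fun_upd[OF occ \<pi> c t]) (fact that)+
    then have "\<Phi> (i(c := t)) \<le> \<Phi> i"
      by (rule max)
    moreover have "\<Phi> i < \<Phi> (i(c := t))"
      unfolding \<Phi>_def using c gt by (intro sum_strict_mono_ex1) auto
    ultimately show False by simp
  qed
  \<comment> \<open>An occurrence says nothing about \<open>i 0\<close> and
    \<open>i (k + 1)\<close>, which the mesh condition fixes, so the boundary values are written in
    afterwards.\<close>
  define i' where "i' = (\<lambda>x. if x = 0 then 0 else if x = k + 1 then n + 1 else i x)"
  define v where "v = (\<lambda>b. if b = 0 then 0 else if b = k + 1 then n + 1 else \<sigma> (i (inv \<pi> b)))"
  have i': "i' x = i x" if "x \<in> {1..k}" for x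
    using that by (simp add: i'_def)
  have v: "v x = \<sigma> (i (inv \<pi> x))" if "x \<in> {1..k}" for x
    using that by (simp add: v_def)
  have v\<pi>: "v (\<pi> x) = \<sigma> (i x)" if "x \<in> {1..k}" for x
    using v[of "\<pi> x"] permutes_in_image[OF \<pi>] that by (simp add: permutes_inverses[OF \<pi>])
  have "occurrence k \<pi> n \<sigma> i'"
    using occ i' unfolding occurrence_def
    by (simp add: strict_mono_on_def image_subset_iff del: One_nat_def)
  moreover have vmono: "strict_mono_on {1..k} v"
    using occurrence_values(1)[OF \<pi> occ] v unfolding strict_mono_on_def by simp
  moreover have "v ` {1..k} = \<sigma> ` i' ` {1..k}"
    using occurrence_values(2)[OF \<pi> occ] v i' by (simp add: image_image del: One_nat_def)
  moreover have "i' 0 = 0 \<and> v 0 = 0 \<and> i' (k + 1) = n + 1 \<and> v (k + 1) = n + 1"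
    by (simp add: i'_def v_def)
  moreover have False if ab: "(a, b) \<in> R" and t: "t \<in> {1..n}"
    and box: "i' a < t" "t < i' (a + 1)" "v b < \<sigma> t" "\<sigma> t < v (b + 1)" for a b t
  proof -
    have le: "a \<le> k" "b \<le> k"
      using ab R by auto
    have i1: "i d < t" if d: "d \<in> {1..k}" "d \<le> a" for d
      using strict_mono_on_leD[OF mono, of d a] i'[of a] d le box(1) by simp
    have i2: "t < i d" if d: "d \<in> {1..k}" "a + 1 \<le> d" for d
      using strict_mono_on_leD[OF mono, of "a + 1" d] i'[of "a + 1"] d le box(2) by simp
    have v1: "\<sigma> (i d) < \<sigma> t" if d: "d \<in> {1..k}" "\<pi> d \<le> b" for d
      using strict_mono_on_leD[OF vmono, of "\<pi> d" b] v\<pi>[of d] permutes_in_image[OF \<pi>, of d] d le box(3)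
      by simp
    have v2: "\<sigma> t < \<sigma> (i d)" if d: "d \<in> {1..k}" "b + 1 \<le> \<pi> d" for d
      using strict_mono_on_leD[OF vmono, of "b + 1" "\<pi> d"] v\<pi>[of d] permutes_in_image[OF \<pi>, of d]
        d le box(4)
      by simp
    \<comment> \<open>The point \<open>c\<close> of \<open>\<pi>\<close> is a corner of the square
      containing \<open>t\<close>, so \<open>t\<close> can replace the entry at \<open>c\<close>
      without crossing another entry, and the selection makes \<open>\<phi>\<close> grow.\<close>
    obtain c where c: "c \<in> {1..k}" and dir:
      "(c = a \<and> \<pi> c = b \<and> up c) \<or> (c = a + 1 \<and> \<pi> c = b + 1 \<and> \<not> up c) \<or>
       (c = a + 1 \<and> \<pi> c = b \<and> left c) \<or> (c = a \<and> \<pi> c = b + 1 \<and> \<not> left c)"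
      using sel[OF ab] by blast
    have ic: "i c \<in> {1..n}"
      using sub c by blast
    have bounds: "i c \<le> n" "\<sigma> (i c) \<le> n" "t \<le> n" "\<sigma> t \<le> n"
      using ic t \<sigma>n[OF ic] \<sigma>n[OF t] by simp_all
    have near: "c = a \<or> c = a + 1" "\<pi> c = b \<or> \<pi> c = b + 1"
      using dir by blast+
    have "i c < t \<and> \<sigma> (i c) < \<sigma> t \<and> up c \<or> t < i c \<and> \<sigma> t < \<sigma> (i c) \<and> \<not> up c \<or>
      t < i c \<and> \<sigma> (i c) < \<sigma> t \<and> left c \<or> i c < t \<and> \<sigma> t < \<sigma> (i c) \<and> \<not> left c"
      using dir i1[OF c] i2[OF c] v1[OF c] v2[OF c] by (metis order_refl)
    then have "\<phi> c (i c) < \<phi> c t"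
      unfolding \<phi>_def using bounds by (elim disjE conjE) (simp_all add: diff_less_mono2)
    then show False
    proof (rule push[OF c t])
      fix d assume d: "d \<in> {1..k}"
      show "i d < t" if "d < c"
        using near(1) that by (intro i1[OF d]) linarith
      show "t < i d" if "c < d"
        using near(1) that by (intro i2[OF d]) linarith
      show "\<sigma> (i d) < \<sigma> t" if "\<pi> d < \<pi> c"
        using near(2) that by (intro v1[OF d]) linarith
      show "\<sigma> t < \<sigma> (i d)" if "\<pi> c < \<pi> d"
        using near(2) that by (intro v2[OF d]) linarith
    qed
  qed
  ultimately show "mesh_contains k \<pi> R n \<sigma>"
    unfolding mesh_contains_def by blast
qed

text \<open>The ball of radius \<open>m\<close> around \<open>H\<close> in the graph of linked
  squares. Unordered pairs let a link be traversed in both directions.\<close>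

fun reach :: "nat \<Rightarrow> (nat \<Rightarrow> nat) \<Rightarrow> (nat \<times> nat) set \<Rightarrow> nat \<Rightarrow> (nat \<times> nat) set" where
  "reach k \<pi> H 0 = H"
| "reach k \<pi> H (Suc m) = reach k \<pi> H m \<union> {s. \<exists>c\<in>{1..k}. \<exists>r\<in>reach k \<pi> H m.
     {r, s} = {(c - 1, \<pi> c - 1), (c, \<pi> c)} \<or> {r, s} = {(c - 1, \<pi> c), (c, \<pi> c - 1)}}"

lemma corner_closed_reach: "corner_closed k \<pi> (\<Union>m. reach k \<pi> H m)"
proof -
  have *: "s \<in> (\<Union>m. reach k \<pi> H m)" if r: "r \<in> (\<Union>m. reach k \<pi> H m)" and cs: "c \<in> {1..k}"
    "{r, s} = {(c - 1, \<pi> c - 1), (c, \<pi> c)} \<or> {r, s} = {(c - 1, \<pi> c), (c, \<pi> c - 1)}" for r s c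
  proof -
    obtain m where "r \<in> reach k \<pi> H m"
      using r by blast
    then have "s \<in> reach k \<pi> H (Suc m)"
      unfolding reach.simps using cs by blast
    then show ?thesis by blast
  qed
  show ?thesis
    unfolding corner_closed_def
    by (intro ballI conjI iffI; rule *; (assumption | blast))
qed

text \<open>The squares never reached from the holes \<open>- R\<close> form a closed set inside
  \<open>R\<close>, which must be empty. So every square has a finite distance to the holes, and
  every square of \<open>R\<close> has a linked neighbour at smaller distance.\<close>

lemma superfluous_if_no_corner_closed:
  assumes \<pi>: "\<pi> permutes {1..k}" and R: "R \<subseteq> {0..k} \<times> {0..k}"
    and C: "\<And>C. corner_closed k \<pi> C \<Longrightarrow> C \<subseteq> R \<Longrightarrow> C = {}"
  shows "superfluous k \<pi> R"
proof -
  let ?H = "reach k \<pi> (- R)"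
  have "corner_closed k \<pi> (- (\<Union>m. ?H m))"
    by (intro corner_closed_Compl corner_closed_reach)
  moreover have "- (\<Union>m. ?H m) \<subseteq> R"
    using UN_upper[of 0 UNIV ?H] by auto
  ultimately have all: "\<exists>m. s \<in> ?H m" for s
    using C by blast
  define d where "d = (\<lambda>s. LEAST m. s \<in> ?H m)"
  have d: "s \<in> ?H (d s)" for s
    unfolding d_def using all by (rule LeastI_ex)
  have step: "\<exists>c\<in>{1..k}. \<exists>r. d r < d s \<and>
      ({r, s} = {(c - 1, \<pi> c - 1), (c, \<pi> c)} \<or> {r, s} = {(c - 1, \<pi> c), (c, \<pi> c - 1)})"
    if "s \<in> R" for s
  proof (cases "d s")
    case 0
    then show ?thesis using d[of s] that by simp
  next
    case (Suc m)
    then have "s \<notin> ?H m"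
      unfolding d_def using not_less_Least[of m "\<lambda>m. s \<in> ?H m"] by simp
    then obtain c r where "c \<in> {1..k}" "r \<in> ?H m"
      "{r, s} = {(c - 1, \<pi> c - 1), (c, \<pi> c)} \<or> {r, s} = {(c - 1, \<pi> c), (c, \<pi> c - 1)}"
      using d[of s] unfolding Suc reach.simps by blast
    moreover have "d r \<le> m"
      unfolding d_def using \<open>r \<in> ?H m\<close> by (rule Least_le)
    ultimately show ?thesis
      using Suc by (metis le_imp_less_Suc)
  qed
  have pos: "0 < \<pi> c" if "c \<in> {1..k}" for c
    using permutes_in_image[OF \<pi>, of c] that by auto
  \<comment> \<open>Each point selects its square farther from the holes, so that an entry pushed
    into a selected square of \<open>R\<close> leaves its old point in the closer one.\<close>
  define up where "up = (\<lambda>c. d (c - 1, \<pi> c - 1) < d (c, \<pi> c))"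
  define left where "left = (\<lambda>c. d (c, \<pi> c - 1) < d (c - 1, \<pi> c))"
  show ?thesis
  proof (rule superfluous_if_selected[OF \<pi> R, of up left])
    fix a b assume ab: "(a, b) \<in> R"
    obtain c r where c: "c \<in> {1..k}" and r: "d r < d (a, b)"
      "{r, (a, b)} = {(c - 1, \<pi> c - 1), (c, \<pi> c)} \<or> {r, (a, b)} = {(c - 1, \<pi> c), (c, \<pi> c - 1)}"
      using step[OF ab] by blast
    have "(a, b) = (c, \<pi> c) \<and> up c \<or> (a, b) = (c - 1, \<pi> c - 1) \<and> \<not> up c \<or>
      (a, b) = (c - 1, \<pi> c) \<and> left c \<or> (a, b) = (c, \<pi> c - 1) \<and> \<not> left c"
      using r(2) unfolding doubleton_eq_iff
    proof (elim disjE conjE)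
      assume "r = (c - 1, \<pi> c - 1)" "(a, b) = (c, \<pi> c)"
      then show ?thesis using r(1) unfolding up_def by metis
    next
      assume "r = (c, \<pi> c)" "(a, b) = (c - 1, \<pi> c - 1)"
      then show ?thesis using r(1) unfolding up_def by (metis less_asym)
    next
      assume "r = (c - 1, \<pi> c)" "(a, b) = (c, \<pi> c - 1)"
      then show ?thesis using r(1) unfolding left_def by (metis less_asym)
    next
      assume "r = (c, \<pi> c - 1)" "(a, b) = (c - 1, \<pi> c)"
      then show ?thesis using r(1) unfolding left_def by metis
    qed
    then show "\<exists>c\<in>{1..k}.
      (c = a \<and> \<pi> c = b \<and> up c) \<or> (c = a + 1 \<and> \<pi> c = b + 1 \<and> \<not> up c) \<or>
      (c = a + 1 \<and> \<pi> c = b \<and> left c) \<or> (c = a \<and> \<pi> c = b + 1 \<and> \<not> left c)"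
      using c pos[OF c] by (intro bexI[OF _ c]) auto
  qed
qed

lemma superfluous_iff_no_corner_closed:
  assumes "\<pi> permutes {1..k}" and "R \<subseteq> {0..k} \<times> {0..k}"
  shows "superfluous k \<pi> R \<longleftrightarrow> (\<forall>C. corner_closed k \<pi> C \<and> C \<subseteq> R \<longrightarrow> C = {})"
  using superfluous_if_no_corner_closed[OF assms] not_superfluous_if_corner_closed[OF assms] by blast

section \<open>Enclosed diagonals\<close>

text \<open>Read \<open>P i\<close> as \<open>i\<close> and \<open>Suc i\<close> lying in one run;
  then \<open>run_length P e\<close> is the rank of \<open>e\<close> in its run. The predicates in
  use are false at \<open>0\<close>, so that a run starts at \<open>1\<close>.\<close>

fun run_length :: "(nat \<Rightarrow> bool) \<Rightarrow> nat \<Rightarrow> nat" where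
  "run_length P 0 = 0"
| "run_length P (Suc e) = (if P e then Suc (run_length P e) else 1)"

lemma run_length_pos: "0 < e \<Longrightarrow> 0 < run_length P e"
  by (cases e) auto

lemma run_length_le: "\<not> P 0 \<Longrightarrow> run_length P e \<le> e"
  by (induction e) (auto simp: neq0_conv)

lemma run_length_step: "0 < x \<Longrightarrow> x < run_length P e \<Longrightarrow> P (e - x)"
proof (induction e arbitrary: x)
  case (Suc e)
  then obtain y where y: "x = Suc y" "P e" "y < run_length P e"
    by (cases x) (auto split: if_splits)
  then show ?case
    using Suc.IH[of y] by (cases "y = 0") auto
qed simp

lemma run_length_start: "\<not> P 0 \<Longrightarrow> \<not> P (e - run_length P e)"
  by (induction e) auto

section \<open>Increasing runs and the chains around them\<close>

definition succ_at :: "nat \<Rightarrow> (nat \<Rightarrow> nat) \<Rightarrow> nat \<Rightarrow> bool" where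
  "succ_at k f i \<longleftrightarrow> 1 \<le> i \<and> i < k \<and> f (Suc i) = Suc (f i)"

lemma not_succ_at_0 [simp]: "\<not> succ_at k f 0"
  by (simp add: succ_at_def)

lemma run_length_succ_at:
  "e \<in> {1..k} \<Longrightarrow> x < run_length (succ_at k f) e \<Longrightarrow> f (e - x) + x = f e"
proof (induction x)
  case (Suc x)
  then have "succ_at k f (e - Suc x)" "Suc x < e"
    using run_length_step[of "Suc x" "succ_at k f" e] run_length_le[of "succ_at k f" e] by auto
  then show ?case
    using Suc by (simp add: succ_at_def Suc_diff_Suc)
qed simp

text \<open>If a run ends at \<open>e\<close>, its \<open>r\<close> points are the shared corners of
  \<open>r + 1\<close> squares, the last of which has its south-west corner at
  \<open>(e, f e)\<close>.\<close>

definition inc_chain :: "nat \<Rightarrow> (nat \<Rightarrow> nat) \<Rightarrow> nat \<Rightarrow> (nat \<times> nat) set" where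
  "inc_chain k f e = (let r = run_length (succ_at k f) e in (\<lambda>x. (e - r + x, f e - r + x)) ` {..<Suc r})"

definition ends :: "nat \<Rightarrow> (nat \<Rightarrow> nat) \<Rightarrow> nat set" where
  "ends k f = {e\<in>{1..k}. \<not> succ_at k f e}"

lemma mem_perm_graph: "(a, b) \<in> perm_graph k f \<longleftrightarrow> a \<in> {1..k} \<and> f a = b"
  by (auto simp: perm_graph_def)

text \<open>The run enters with a positive value and rises by one up to \<open>f e\<close>. This
  keeps \<open>f e - r\<close> in \<open>inc_chain\<close> from truncating.\<close>

lemma run_length_le_value:
  assumes f: "f permutes {1..k}" and e: "e \<in> {1..k}"
  shows "run_length (succ_at k f) e \<le> f e"
proof -
  let ?r = "run_length (succ_at k f) e"
  have r: "0 < ?r" "?r \<le> e"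
    using e run_length_pos[of e] run_length_le[of "succ_at k f" e] by auto
  then have "e - (?r - 1) \<in> {1..k}"
    using e by auto
  then have "f (e - (?r - 1)) \<in> {1..k}"
    using permutes_in_image[OF f] by blast
  then show ?thesis
    using run_length_succ_at[OF e, of "?r - 1" f] r by auto
qed

text \<open>The shared corners of a chain are successive points of one run. That the two extreme
  corners miss the graph means that the run extends neither backwards nor forwards.\<close>

lemma increasing_chain_iff:
  assumes f: "f permutes {1..k}"
  shows "2 \<le> h \<and> increasing_chain k f i j h \<longleftrightarrow>
    (\<exists>e\<in>ends k f. i + run_length (succ_at k f) e = e \<and> j + run_length (succ_at k f) e = f e \<and>
       h = Suc (run_length (succ_at k f) e))"
    (is "?L \<longleftrightarrow> (\<exists>e\<in>_. i + ?r e = e \<and> j + ?r e = f e \<and> h = Suc (?r e))")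
proof
  assume L: ?L
  have G: "i + x \<in> {1..k} \<and> f (i + x) = j + x" if "1 \<le> x" "x < h" for x
    using L that unfolding increasing_chain_def mem_perm_graph by blast
  have start: "\<not> succ_at k f i"
    using L G[of 1] unfolding increasing_chain_def mem_perm_graph by (auto simp: succ_at_def)
  have r: "?r (i + x) = x" if "1 \<le> x" "x < h" for x
    using that
  proof (induction x rule: nat_induct_at_least)
    case base
    then show ?case using start by simp
  next
    case (Suc x)
    then have "succ_at k f (i + x)"
      using G[of x] G[of "Suc x"] by (auto simp: succ_at_def)
    then show ?case using Suc by simp
  qed
  define e where "e = i + (h - 1)"
  have e: "e \<in> {1..k}" "f e = j + (h - 1)" "?r e = h - 1"
    using G[of "h - 1"] r[of "h - 1"] L by (auto simp: e_def)
  have "\<not> succ_at k f e"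
  proof
    assume "succ_at k f e"
    then have "Suc e = i + h \<and> i + h \<in> {1..k} \<and> f (i + h) = j + h"
      using e(2) L by (auto simp: succ_at_def e_def)
    then show False
      using L unfolding increasing_chain_def mem_perm_graph by blast
  qed
  then show "\<exists>e\<in>ends k f. i + ?r e = e \<and> j + ?r e = f e \<and> h = Suc (?r e)"
    using e L by (intro bexI[of _ e]) (auto simp: ends_def e_def)
next
  assume "\<exists>e\<in>ends k f. i + ?r e = e \<and> j + ?r e = f e \<and> h = Suc (?r e)"
  then obtain e where e: "e \<in> {1..k}" "\<not> succ_at k f e" and i: "i + ?r e = e"
    and j: "j + ?r e = f e" and h: "h = Suc (?r e)"
    by (auto simp: ends_def)
  have r: "0 < ?r e"
    using e run_length_pos[of e] by auto
  have fe: "f e \<in> {1..k}"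
    using permutes_in_image[OF f] e by blast
  have G: "i + x \<in> {1..k} \<and> f (i + x) = j + x" if x: "1 \<le> x" "x < h" for x
  proof -
    have "e - (?r e - x) = i + x"
      using i x h by linarith
    moreover have "?r e - x < ?r e"
      using x r by linarith
    ultimately have "f (i + x) + (?r e - x) = f e"
      using run_length_succ_at[OF e(1), of "?r e - x" f] by simp
    then show ?thesis
      using x h i j e(1) by auto
  qed
  have "\<not> (i \<in> {1..k} \<and> f i = j)"
  proof
    assume "i \<in> {1..k} \<and> f i = j"
    then have "succ_at k f i"
      using G[of 1] r h by (simp add: succ_at_def)
    then show False
      using run_length_start[of "succ_at k f" e] i by (metis add_diff_cancel_right' not_succ_at_0)
  qed
  moreover have "\<not> (i + h \<in> {1..k} \<and> f (i + h) = j + h)"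
    using e i j h by (auto simp: succ_at_def)
  moreover have "i + x \<le> k \<and> j + x \<le> k" if "x < h" for x
    using that h i j e fe by auto
  ultimately show ?L
    using G h r unfolding increasing_chain_def mem_perm_graph by auto
qed

definition inc_chains :: "nat \<Rightarrow> (nat \<Rightarrow> nat) \<Rightarrow> (nat \<times> nat) set set" where
  "inc_chains k f = {(\<lambda>x. (i + x, j + x)) ` {..<h} | i j h. 2 \<le> h \<and> increasing_chain k f i j h}"

lemma inc_chains_eq:
  assumes f: "f permutes {1..k}"
  shows "inc_chains k f = inc_chain k f ` ends k f"
proof (intro equalityI subsetI)
  fix c assume "c \<in> inc_chains k f"
  then obtain i j h where c: "c = (\<lambda>x. (i + x, j + x)) ` {..<h}"
    and "2 \<le> h \<and> increasing_chain k f i j h"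
    by (auto simp: inc_chains_def)
  then obtain e where "e \<in> ends k f" "i + run_length (succ_at k f) e = e"
    "j + run_length (succ_at k f) e = f e" "h = Suc (run_length (succ_at k f) e)"
    unfolding increasing_chain_iff[OF f] by blast
  then have "e \<in> ends k f" "i = e - run_length (succ_at k f) e" "j = f e - run_length (succ_at k f) e"
    "h = Suc (run_length (succ_at k f) e)"
    by linarith+
  then show "c \<in> inc_chain k f ` ends k f"
    unfolding c inc_chain_def Let_def by blast
next
  fix c assume "c \<in> inc_chain k f ` ends k f"
  then obtain e where e: "e \<in> ends k f" and c: "c = inc_chain k f e"
    by blast
  let ?r = "run_length (succ_at k f) e"
  have "e - ?r + ?r = e" "f e - ?r + ?r = f e"
    using e run_length_le[of "succ_at k f" e] run_length_le_value[OF f, of e] by (auto simp: ends_def)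
  then have "2 \<le> Suc ?r \<and> increasing_chain k f (e - ?r) (f e - ?r) (Suc ?r)"
    unfolding increasing_chain_iff[OF f] using e by blast
  then show "c \<in> inc_chains k f"
    unfolding inc_chains_def c inc_chain_def Let_def by blast
qed

lemma card_inc_chain: "card (inc_chain k f e) = Suc (run_length (succ_at k f) e)"
  unfolding inc_chain_def Let_def by (subst card_image) (auto simp: inj_on_def)

lemma end_mem_inc_chain:
  assumes "f permutes {1..k}" "e \<in> {1..k}"
  shows "(e, f e) \<in> inc_chain k f e"
  using run_length_le[of "succ_at k f" e] run_length_le_value[OF assms]
  unfolding inc_chain_def Let_def by (intro image_eqI[of _ _ "run_length (succ_at k f) e"]) auto

lemma fst_inc_chain_le: "s \<in> inc_chain k f e \<Longrightarrow> fst s \<le> e"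
  using run_length_le[of "succ_at k f" e] by (auto simp: inc_chain_def Let_def)

lemma inj_on_inc_chain:
  assumes f: "f permutes {1..k}"
  shows "inj_on (inc_chain k f) (ends k f)"
proof (rule inj_onI)
  fix d e assume "d \<in> ends k f" "e \<in> ends k f" "inc_chain k f d = inc_chain k f e"
  then have "(d, f d) \<in> inc_chain k f e" "(e, f e) \<in> inc_chain k f d"
    using end_mem_inc_chain[OF f] by (auto simp: ends_def)
  then show "d = e"
    using fst_inc_chain_le by (metis fst_conv order_antisym)
qed

lemma inc_chains_cover:
  assumes f: "f permutes {1..k}" and c: "c \<in> {1..k}"
  shows "(c - 1, f c - 1) \<in> \<Union>(inc_chains k f)" "(c, f c) \<in> \<Union>(inc_chains k f)"
proof -
  let ?r = "run_length (succ_at k f)"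
  have "c \<le> k" "1 \<le> c"
    using c by auto
  then have "\<exists>e\<in>ends k f. c \<le> e \<and> e - c < ?r e"
  proof (induction rule: inc_induct)
    case base
    then show ?case
      using run_length_pos[of k] by (intro bexI[of _ k]) (auto simp: ends_def succ_at_def)
  next
    case (step n)
    show ?case
    proof (cases "succ_at k f n")
      case False
      then show ?thesis
        using step run_length_pos[of n] by (intro bexI[of _ n]) (auto simp: ends_def)
    next
      case True
      obtain e where e: "e \<in> ends k f" "Suc n \<le> e" "e - Suc n < ?r e"
        using step by auto
      \<comment> \<open>The index \<open>e - ?r e\<close> just before the run of \<open>e\<close> is
        not joined to its successor, whereas \<open>n\<close> is. So \<open>n\<close> belongs to
        that run too.\<close>
      have "e - ?r e \<noteq> n"
        using True run_length_start[of "succ_at k f" e] by auto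
      then have "e - n < ?r e"
        using e by linarith
      then show ?thesis
        using e by (intro bexI[of _ e]) auto
    qed
  qed
  then obtain e where e: "e \<in> ends k f" "c \<le> e" "e - c < ?r e"
    by blast
  have ek: "e \<in> {1..k}"
    using e by (simp add: ends_def)
  have fc: "f c + (e - c) = f e"
    using run_length_succ_at[OF ek e(3)] e(2) by simp
  have r: "?r e \<le> e" "?r e \<le> f e"
    using run_length_le[of "succ_at k f" e] run_length_le_value[OF f ek] by auto
  have "(c, f c) \<in> inc_chain k f e"
    unfolding inc_chain_def Let_def
    by (rule image_eqI[of _ _ "?r e - (e - c)"]) (use e r fc in auto)
  moreover have "(c - 1, f c - 1) \<in> inc_chain k f e"
    unfolding inc_chain_def Let_def
    by (rule image_eqI[of _ _ "?r e - (e - c) - 1"]) (use e r fc in auto)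
  ultimately show "(c - 1, f c - 1) \<in> \<Union>(inc_chains k f)" "(c, f c) \<in> \<Union>(inc_chains k f)"
    unfolding inc_chains_eq[OF f] using e(1) by blast+
qed

lemma inc_chains_subset: "c \<in> inc_chains k f \<Longrightarrow> c \<subseteq> {0..k} \<times> {0..k}"
  by (auto simp: inc_chains_def increasing_chain_def)

lemma inc_chains_nonempty: "c \<in> inc_chains k f \<Longrightarrow> c \<noteq> {}"
  by (force simp: inc_chains_def lessThan_empty_iff)

text \<open>Along the chain, links could lead out only at the extreme corners, which are not in the
  graph. A link across the other diagonal of a square would need a point sharing a row or a column
  with a point of the chain.\<close>

lemma corner_closed_inc_chains:
  assumes f: "f permutes {1..k}" and c: "c \<in> inc_chains k f"
  shows "corner_closed k f c"
proof -
  obtain i j h where c: "c = (\<lambda>x. (i + x, j + x)) ` {..<h}" and h: "2 \<le> h"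
    and inc: "increasing_chain k f i j h"
    using c by (auto simp: inc_chains_def)
  have mem: "(a, b) \<in> c \<longleftrightarrow> (\<exists>x<h. a = i + x \<and> b = j + x)" for a b
    by (auto simp: c)
  have G: "i + x \<in> {1..k} \<and> f (i + x) = j + x" if "1 \<le> x" "x < h" for x
    using inc that unfolding increasing_chain_def mem_perm_graph by blast
  have no: "\<not> (i \<in> {1..k} \<and> f i = j)" "\<not> (i + h \<in> {1..k} \<and> f (i + h) = j + h)"
    using inc unfolding increasing_chain_def mem_perm_graph by blast+
  show ?thesis
    unfolding corner_closed_def
  proof (intro ballI conjI)
    fix d assume d: "d \<in> {1..k}"
    have fd: "f d \<in> {1..k}"
      using permutes_in_image[OF f] d by blast
    show "(d - 1, f d - 1) \<in> c \<longleftrightarrow> (d, f d) \<in> c"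
    proof
      assume "(d - 1, f d - 1) \<in> c"
      then obtain x where "x < h" "d - 1 = i + x" "f d - 1 = j + x"
        unfolding mem by auto
      then have x: "x < h" "d = i + Suc x" "f d = j + Suc x"
        using d fd by auto
      then have "Suc x \<noteq> h"
        using no(2) d by auto
      then show "(d, f d) \<in> c"
        using x unfolding mem by (intro exI[of _ "Suc x"]) simp
    next
      assume "(d, f d) \<in> c"
      then obtain x where x: "x < h" "d = i + x" "f d = j + x"
        unfolding mem by auto
      then have "x \<noteq> 0"
        using no(1) d by (cases x) auto
      then show "(d - 1, f d - 1) \<in> c"
        using x unfolding mem by (intro exI[of _ "x - 1"]) auto
    qed
    have "(d - 1, f d) \<notin> c"
    proof
      assume "(d - 1, f d) \<in> c"
      then obtain x where "x < h" "d - 1 = i + x" "f d = j + x"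
        unfolding mem by auto
      then have x: "x < h" "d = i + Suc x" "f d = j + x"
        using d by auto
      show False
      proof (cases "x = 0")
        case True
        then show False using x G[of 1] h by simp
      next
        case False
        then have "f (i + x) = f d"
          using x G[of x] by simp
        then have "i + x = d"
          by (rule injD[OF permutes_inj[OF f]])
        then show False
          using x by simp
      qed
    qed
    moreover have "(d, f d - 1) \<notin> c"
    proof
      assume "(d, f d - 1) \<in> c"
      then obtain x where "x < h" "d = i + x" "f d - 1 = j + x"
        unfolding mem by auto
      then have x: "x < h" "d = i + x" "f d = Suc (j + x)"
        using fd by auto
      show False
      proof (cases "x = 0")
        case True
        then have "f (i + 1) = f d"
          using x G[of 1] h by simp
        then have "i + 1 = d"
          by (rule injD[OF permutes_inj[OF f]])
        then show False
          using x True by simp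
      next
        case False
        then show False using x G[of x] by simp
      qed
    qed
    ultimately show "(d - 1, f d) \<in> c \<longleftrightarrow> (d, f d - 1) \<in> c"
      by blast
  qed
qed

text \<open>Successive squares of a chain are linked, so membership in \<open>C\<close> is constant
  along it.\<close>

lemma inc_chains_connected:
  assumes c: "c \<in> inc_chains k f" and C: "corner_closed k f C" "c \<inter> C \<noteq> {}"
  shows "c \<subseteq> C"
proof -
  obtain i j h where c: "c = (\<lambda>x. (i + x, j + x)) ` {..<h}" and inc: "increasing_chain k f i j h"
    using c by (auto simp: inc_chains_def)
  have "(i + x, j + x) \<in> C \<longleftrightarrow> (i, j) \<in> C" if "x < h" for x
    using that
  proof (induction x)
    case (Suc x)
    have "(i + Suc x, j + Suc x) \<in> perm_graph k f"
      using inc Suc.prems unfolding increasing_chain_def by auto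
    then have "i + Suc x \<in> {1..k}" "f (i + Suc x) = j + Suc x"
      unfolding mem_perm_graph by auto
    then have "(i + Suc x - 1, j + Suc x - 1) \<in> C \<longleftrightarrow> (i + Suc x, j + Suc x) \<in> C"
      using C(1) unfolding corner_closed_def by metis
    then show ?case
      using Suc by simp
  qed simp
  then show ?thesis
    using C(2) unfolding c by auto
qed

lemma card_ends: "1 \<le> k \<Longrightarrow> card (ends k f) + card {i\<in>{1..<k}. succ_at k f i} = k"
proof -
  assume "1 \<le> k"
  have "{1..k} = ends k f \<union> {i\<in>{1..<k}. succ_at k f i}"
    by (auto simp: ends_def succ_at_def)
  moreover have "card (ends k f \<union> {i\<in>{1..<k}. succ_at k f i}) =
      card (ends k f) + card {i\<in>{1..<k}. succ_at k f i}"
    by (rule card_Un_disjoint) (auto simp: ends_def)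
  ultimately show ?thesis
    by (metis card_atLeastAtMost add_diff_cancel_right' Suc_eq_plus1)
qed

section \<open>Reflecting decreasing chains into increasing ones\<close>

definition rev_perm :: "nat \<Rightarrow> nat \<Rightarrow> nat" where
  "rev_perm k x = (if x \<in> {1..k} then k + 1 - x else x)"

lemma rev_perm_rev_perm [simp]: "rev_perm k (rev_perm k x) = x"
  by (auto simp: rev_perm_def)

lemma rev_perm_permutes: "rev_perm k permutes {1..k}"
  unfolding permutes_def by (metis rev_perm_def rev_perm_rev_perm)

lemma rev_perm_comp_permutes: "\<pi> permutes {1..k} \<Longrightarrow> rev_perm k \<circ> \<pi> permutes {1..k}"
  using rev_perm_permutes permutes_compose by blast

text \<open>The reflection \<open>rev_perm\<close> acting on squares. Values go to
  \<open>k + 1 - y\<close>, but the south-west corner of the image comes from the north-west corner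
  of the square, whence \<open>k - b\<close>.\<close>

definition flip :: "nat \<Rightarrow> nat \<times> nat \<Rightarrow> nat \<times> nat" where
  "flip k s = (fst s, k - snd s)"

lemma flip_flip: "s \<in> {0..k} \<times> {0..k} \<Longrightarrow> flip k (flip k s) = s"
  by (auto simp: flip_def)

lemma flip_image_flip_image:
  assumes "C \<subseteq> {0..k} \<times> {0..k}"
  shows "flip k ` flip k ` C = C"
proof -
  have "(\<lambda>s. flip k (flip k s)) ` C = (\<lambda>s. s) ` C"
    by (intro image_cong refl flip_flip) (use assms in blast)
  then show ?thesis
    by (simp add: image_image)
qed

lemma mem_flip_image:
  assumes "C \<subseteq> {0..k} \<times> {0..k}" "b \<le> k"
  shows "(a, b) \<in> flip k ` C \<longleftrightarrow> (a, k - b) \<in> C"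
proof
  assume "(a, b) \<in> flip k ` C"
  then show "(a, k - b) \<in> C"
    using assms by (auto simp: flip_def)
next
  assume "(a, k - b) \<in> C"
  then show "(a, b) \<in> flip k ` C"
    using assms by (intro image_eqI[of _ _ "(a, k - b)"]) (auto simp: flip_def)
qed

lemma corner_closed_flip:
  assumes \<pi>: "\<pi> permutes {1..k}" and C: "corner_closed k \<pi> C" "C \<subseteq> {0..k} \<times> {0..k}"
  shows "corner_closed k (rev_perm k \<circ> \<pi>) (flip k ` C)"
  unfolding corner_closed_def
proof
  fix c assume c: "c \<in> {1..k}"
  let ?p = "\<pi> c"
  have p: "1 \<le> ?p" "?p \<le> k"
    using permutes_in_image[OF \<pi>, of c] c by auto
  have r: "(rev_perm k \<circ> \<pi>) c = k + 1 - ?p"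
    using p by (simp add: rev_perm_def)
  have eqs: "k - (k + 1 - ?p - 1) = ?p" "k - (k + 1 - ?p) = ?p - 1" "k + 1 - ?p - 1 \<le> k"
    "k + 1 - ?p \<le> k"
    using p by auto
  show "((c - 1, (rev_perm k \<circ> \<pi>) c - 1) \<in> flip k ` C \<longleftrightarrow> (c, (rev_perm k \<circ> \<pi>) c) \<in> flip k ` C) \<and>
    ((c - 1, (rev_perm k \<circ> \<pi>) c) \<in> flip k ` C \<longleftrightarrow> (c, (rev_perm k \<circ> \<pi>) c - 1) \<in> flip k ` C)"
    unfolding r mem_flip_image[OF C(2) eqs(3)] mem_flip_image[OF C(2) eqs(4)] eqs(1,2)
    using C(1) c unfolding corner_closed_def by blast
qed

text \<open>The reflection of squares is an involution on the grid only, so closed sets are first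
  cut down to it. No link is broken, since all squares around points of \<open>\<pi>\<close> lie in
  the grid.\<close>

lemma corner_closed_Int_grid:
  assumes \<pi>: "\<pi> permutes {1..k}" and C: "corner_closed k \<pi> C"
  shows "corner_closed k \<pi> (C \<inter> {0..k} \<times> {0..k})"
proof -
  have "c - 1 \<le> k \<and> c \<le> k \<and> \<pi> c - 1 \<le> k \<and> \<pi> c \<le> k" if "c \<in> {1..k}" for c
    using permutes_in_image[OF \<pi>, of c] that by auto
  then show ?thesis
    using C unfolding corner_closed_def by simp
qed

definition dec_chains :: "nat \<Rightarrow> (nat \<Rightarrow> nat) \<Rightarrow> (nat \<times> nat) set set" where
  "dec_chains k \<pi> = {(\<lambda>x. (i + x, j - x)) ` {..<h} | i j h. 2 \<le> h \<and> decreasing_chain k \<pi> i j h}"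

lemma decreasing_chain_iff:
  assumes \<pi>: "\<pi> permutes {1..k}" and j: "j \<le> k" and h: "1 \<le> h"
  shows "decreasing_chain k \<pi> i j h \<longleftrightarrow> increasing_chain k (rev_perm k \<circ> \<pi>) i (k - j) h"
proof -
  have G: "(a, j + 1 - x) \<in> perm_graph k \<pi> \<longleftrightarrow> (a, k - j + x) \<in> perm_graph k (rev_perm k \<circ> \<pi>)"
    if "x \<le> j + 1" for a x
  proof (cases "a \<in> {1..k}")
    case True
    then have "\<pi> a \<in> {1..k}"
      using permutes_in_image[OF \<pi>] by blast
    then show ?thesis
      using that j True unfolding mem_perm_graph by (auto simp: rev_perm_def)
  qed (simp only: mem_perm_graph simp_thms)
  have sq: "(\<forall>x<h. x \<le> j \<and> (i + x, j - x) \<in> {0..k} \<times> {0..k}) \<longleftrightarrow>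
      (\<forall>x<h. (i + x, k - j + x) \<in> {0..k} \<times> {0..k})"
    using j by auto
  show ?thesis
  proof (cases "\<forall>x<h. (i + x, k - j + x) \<in> {0..k} \<times> {0..k}")
    case True
    \<comment> \<open>The last square of the chain gives this bound, with which
      \<open>j + 1 - x\<close> is exact up to the final corner \<open>x = h\<close>.\<close>
    then have hj: "h \<le> j + 1"
      using h j by (auto dest!: spec[of _ "h - 1"])
    have "(i + x, j + 1 - x) \<in> perm_graph k \<pi> \<longleftrightarrow> (i + x, k - j + x) \<in> perm_graph k (rev_perm k \<circ> \<pi>)"
      if "x \<le> h" for x
      using G that hj by simp
    then show ?thesis
      using G[of 0 i] unfolding decreasing_chain_def increasing_chain_def sq by auto
  next
    case False
    then show ?thesis
      unfolding decreasing_chain_def increasing_chain_def sq by blast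
  qed
qed

lemma dec_chains_eq:
  assumes \<pi>: "\<pi> permutes {1..k}"
  shows "dec_chains k \<pi> = (`) (flip k) ` inc_chains k (rev_perm k \<circ> \<pi>)"
proof -
  have img: "flip k ` (\<lambda>x. (i + x, k - j + x)) ` {..<h} = (\<lambda>x. (i + x, j - x)) ` {..<h}"
    if "j \<le> k" for i j h :: nat
    unfolding image_image using that by (intro image_cong) (auto simp: flip_def)
  show ?thesis
  proof (intro equalityI subsetI)
    fix c assume "c \<in> dec_chains k \<pi>"
    then obtain i j h where c: "c = (\<lambda>x. (i + x, j - x)) ` {..<h}" and h: "2 \<le> h"
      and dec: "decreasing_chain k \<pi> i j h"
      by (auto simp: dec_chains_def)
    then have j: "j \<le> k"
      unfolding decreasing_chain_def by (auto dest!: spec[of _ 0])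
    have "increasing_chain k (rev_perm k \<circ> \<pi>) i (k - j) h"
      using dec h decreasing_chain_iff[OF \<pi> j] by simp
    then show "c \<in> (`) (flip k) ` inc_chains k (rev_perm k \<circ> \<pi>)"
      unfolding c img[OF j, symmetric] inc_chains_def using h by blast
  next
    fix c assume "c \<in> (`) (flip k) ` inc_chains k (rev_perm k \<circ> \<pi>)"
    then obtain i j' h where c: "c = flip k ` (\<lambda>x. (i + x, j' + x)) ` {..<h}" and h: "2 \<le> h"
      and inc: "increasing_chain k (rev_perm k \<circ> \<pi>) i j' h"
      by (auto simp: inc_chains_def)
    have j': "j' \<le> k"
      using inc h unfolding increasing_chain_def by (auto dest!: spec[of _ 0])
    define j where "j = k - j'"
    have j: "j \<le> k" "j' = k - j"
      using j' by (auto simp: j_def)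
    have "decreasing_chain k \<pi> i j h"
      using inc h decreasing_chain_iff[OF \<pi> j(1)] unfolding j(2) by simp
    then show "c \<in> dec_chains k \<pi>"
      unfolding c j(2) img[OF j(1)] dec_chains_def using h by blast
  qed
qed

section \<open>Diagonals as components of linked squares\<close>

lemma diagonals_to_avoid_eq: "diagonals_to_avoid k \<pi> = inc_chains k \<pi> \<union> dec_chains k \<pi>"
  unfolding diagonals_to_avoid_def inc_chains_def dec_chains_def ..

lemma rev_perm_comp_comp: "rev_perm k \<circ> (rev_perm k \<circ> \<pi>) = \<pi>"
  by (simp add: fun_eq_iff)

lemma diagonals_subset:
  assumes \<pi>: "\<pi> permutes {1..k}" and c: "c \<in> diagonals_to_avoid k \<pi>"
  shows "c \<subseteq> {0..k} \<times> {0..k}"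
proof (cases "c \<in> inc_chains k \<pi>")
  case False
  then obtain d where "d \<in> inc_chains k (rev_perm k \<circ> \<pi>)" "c = flip k ` d"
    using c unfolding diagonals_to_avoid_eq dec_chains_eq[OF \<pi>] by blast
  then show ?thesis
    using inc_chains_subset[of d k "rev_perm k \<circ> \<pi>"] by (auto simp: flip_def)
qed (rule inc_chains_subset)

lemma diagonals_nonempty:
  assumes \<pi>: "\<pi> permutes {1..k}" and c: "c \<in> diagonals_to_avoid k \<pi>"
  shows "c \<noteq> {}"
  using c inc_chains_nonempty[of c k \<pi>] inc_chains_nonempty[of _ k "rev_perm k \<circ> \<pi>"]
  unfolding diagonals_to_avoid_eq dec_chains_eq[OF \<pi>] by auto

lemma corner_closed_diagonals:
  assumes \<pi>: "\<pi> permutes {1..k}" and c: "c \<in> diagonals_to_avoid k \<pi>"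
  shows "corner_closed k \<pi> c"
proof (cases "c \<in> inc_chains k \<pi>")
  case True
  then show ?thesis by (rule corner_closed_inc_chains[OF \<pi>])
next
  case False
  then obtain d where d: "d \<in> inc_chains k (rev_perm k \<circ> \<pi>)" "c = flip k ` d"
    using c unfolding diagonals_to_avoid_eq dec_chains_eq[OF \<pi>] by blast
  note \<pi>' = rev_perm_comp_permutes[OF \<pi>]
  show ?thesis
    using corner_closed_flip[OF \<pi>' corner_closed_inc_chains[OF \<pi>' d(1)] inc_chains_subset[OF d(1)]]
    unfolding rev_perm_comp_comp d(2) .
qed

lemma diagonals_connected:
  assumes \<pi>: "\<pi> permutes {1..k}" and c: "c \<in> diagonals_to_avoid k \<pi>"
    and C: "corner_closed k \<pi> C" "c \<inter> C \<noteq> {}"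
  shows "c \<subseteq> C"
proof (cases "c \<in> inc_chains k \<pi>")
  case True
  then show ?thesis using inc_chains_connected C by blast
next
  case False
  then obtain d where d: "d \<in> inc_chains k (rev_perm k \<circ> \<pi>)" "c = flip k ` d"
    using c unfolding diagonals_to_avoid_eq dec_chains_eq[OF \<pi>] by blast
  let ?grid = "{0..k} \<times> {0..k}"
  have dg: "d \<subseteq> ?grid"
    using inc_chains_subset d by blast
  have "corner_closed k (rev_perm k \<circ> \<pi>) (flip k ` (C \<inter> ?grid))"
    using corner_closed_flip[OF \<pi> corner_closed_Int_grid[OF \<pi> C(1)]] by blast
  moreover have "d \<inter> flip k ` (C \<inter> ?grid) \<noteq> {}"
  proof -
    obtain s where s: "s \<in> d" "flip k s \<in> C"
      using C(2) d by blast
    have "flip k (flip k s) = s"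
      using dg s(1) by (intro flip_flip) blast
    moreover have "flip k s \<in> ?grid"
      using dg s(1) by (auto simp: flip_def)
    ultimately have "s \<in> flip k ` (C \<inter> ?grid)"
      using s(2) by (intro image_eqI[of _ _ "flip k s"]) auto
    then show ?thesis
      using s(1) by blast
  qed
  ultimately have "d \<subseteq> flip k ` (C \<inter> ?grid)"
    using inc_chains_connected[OF d(1)] by blast
  then have "flip k ` d \<subseteq> flip k ` flip k ` (C \<inter> ?grid)"
    by (rule image_mono)
  also have "\<dots> = C \<inter> ?grid"
    by (rule flip_image_flip_image) blast
  finally show ?thesis
    unfolding d(2) by blast
qed

lemma diagonals_cover:
  assumes \<pi>: "\<pi> permutes {1..k}" and c: "c \<in> {1..k}"
  shows "{(c - 1, \<pi> c - 1), (c, \<pi> c), (c - 1, \<pi> c), (c, \<pi> c - 1)} \<subseteq> \<Union>(diagonals_to_avoid k \<pi>)"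
proof -
  note \<pi>' = rev_perm_comp_permutes[OF \<pi>]
  have p: "1 \<le> \<pi> c" "\<pi> c \<le> k"
    using permutes_in_image[OF \<pi>, of c] c by auto
  then have r: "(rev_perm k \<circ> \<pi>) c = k + 1 - \<pi> c"
    by (simp add: rev_perm_def)
  have "flip k (c - 1, k + 1 - \<pi> c - 1) = (c - 1, \<pi> c)" "flip k (c, k + 1 - \<pi> c) = (c, \<pi> c - 1)"
    using p by (auto simp: flip_def)
  moreover have "flip k s \<in> \<Union>(dec_chains k \<pi>)" if "s \<in> \<Union>(inc_chains k (rev_perm k \<circ> \<pi>))" for s
    using that unfolding dec_chains_eq[OF \<pi>] by blast
  ultimately have "(c - 1, \<pi> c) \<in> \<Union>(dec_chains k \<pi>)" "(c, \<pi> c - 1) \<in> \<Union>(dec_chains k \<pi>)"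
    using inc_chains_cover[OF \<pi>' c] unfolding r by metis+
  then show ?thesis
    using inc_chains_cover[OF \<pi> c] unfolding diagonals_to_avoid_eq by simp
qed

lemma superfluous_iff_diagonals:
  assumes \<pi>: "\<pi> permutes {1..k}" and R: "R \<subseteq> {0..k} \<times> {0..k}"
  shows "superfluous k \<pi> R \<longleftrightarrow>
    R \<subseteq> \<Union>(diagonals_to_avoid k \<pi>) \<and> (\<forall>c\<in>diagonals_to_avoid k \<pi>. \<not> c \<subseteq> R)"
  unfolding superfluous_iff_no_corner_closed[OF \<pi> R]
proof (intro iffI conjI ballI allI impI; (elim conjE)?)
  assume noC: "\<forall>C. corner_closed k \<pi> C \<and> C \<subseteq> R \<longrightarrow> C = {}"
  show "R \<subseteq> \<Union>(diagonals_to_avoid k \<pi>)"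
  proof
    fix s assume s: "s \<in> R"
    show "s \<in> \<Union>(diagonals_to_avoid k \<pi>)"
    proof (rule ccontr)
      assume "s \<notin> \<Union>(diagonals_to_avoid k \<pi>)"
      then have "corner_closed k \<pi> {s}"
        using diagonals_cover[OF \<pi>] unfolding corner_closed_def by blast
      then show False
        using noC s by blast
    qed
  qed
  show "\<not> c \<subseteq> R" if "c \<in> diagonals_to_avoid k \<pi>" for c
    using noC corner_closed_diagonals[OF \<pi> that] diagonals_nonempty[OF \<pi> that] by blast
next
  fix C assume "R \<subseteq> \<Union>(diagonals_to_avoid k \<pi>)" "\<forall>c\<in>diagonals_to_avoid k \<pi>. \<not> c \<subseteq> R"
    "corner_closed k \<pi> C" "C \<subseteq> R"
  then show "C = {}"
    using diagonals_connected[OF \<pi>, of _ C] by blast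
qed

section \<open>Counting by choices on disjoint diagonals\<close>

lemma card_no_block_subset:
  assumes "finite D" "\<And>c. c \<in> D \<Longrightarrow> finite c" "disjoint D"
  shows "card {R. R \<subseteq> \<Union>D \<and> (\<forall>c\<in>D. \<not> c \<subseteq> R)} = (\<Prod>c\<in>D. 2 ^ card c - 1)"
  using assms
proof (induction D)
  case empty
  then show ?case by simp
next
  case (insert c D)
  let ?A = "\<lambda>D. {R. R \<subseteq> \<Union>D \<and> (\<forall>c\<in>D. \<not> c \<subseteq> R)}"
  have disj: "c \<inter> \<Union>D = {}"
    using insert by (auto simp: disjoint_def)
  \<comment> \<open>A set containing no block splits into a proper subset of \<open>c\<close> and a
    set of the same kind for \<open>D\<close>; the choices are independent because \<open>c\<close>
    is disjoint from the other blocks.\<close>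
  have "bij_betw (\<lambda>(S, R). S \<union> R) ((Pow c - {c}) \<times> ?A D) (?A (insert c D))"
  proof (rule bij_betw_byWitness[where f' = "\<lambda>R. (R \<inter> c, R \<inter> \<Union>D)"])
    show "\<forall>a\<in>(Pow c - {c}) \<times> ?A D. (\<lambda>R. (R \<inter> c, R \<inter> \<Union>D)) ((\<lambda>(S, R). S \<union> R) a) = a"
      using disj by auto
    show "\<forall>a'\<in>?A (insert c D). (\<lambda>(S, R). S \<union> R) ((\<lambda>R. (R \<inter> c, R \<inter> \<Union>D)) a') = a'"
      by auto
    show "(\<lambda>(S, R). S \<union> R) ` ((Pow c - {c}) \<times> ?A D) \<subseteq> ?A (insert c D)"
    proof (rule image_subsetI)
      fix a assume "a \<in> (Pow c - {c}) \<times> ?A D"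
      then obtain S R where a: "a = (S, R)"
        and *: "S \<subseteq> c" "S \<noteq> c" "R \<subseteq> \<Union>D" "\<forall>c\<in>D. \<not> c \<subseteq> R"
        by auto
      have "\<not> c \<subseteq> S \<union> R"
        using * disj by blast
      moreover have "\<not> d \<subseteq> S \<union> R" if "d \<in> D" for d
      proof
        assume "d \<subseteq> S \<union> R"
        then have "d \<subseteq> R"
          using * disj that by blast
        then show False using * that by blast
      qed
      moreover have "S \<union> R \<subseteq> \<Union>(insert c D)"
        using *(1,3) by auto
      ultimately show "(\<lambda>(S, R). S \<union> R) a \<in> ?A (insert c D)"
        by (simp add: a)
    qed
    show "(\<lambda>R. (R \<inter> c, R \<inter> \<Union>D)) ` ?A (insert c D) \<subseteq> (Pow c - {c}) \<times> ?A D"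
      by auto
  qed
  then have "card (?A (insert c D)) = card ((Pow c - {c}) \<times> ?A D)"
    by (rule bij_betw_same_card[symmetric])
  also have "\<dots> = (2 ^ card c - 1) * card (?A D)"
    using insert.prems by (simp add: card_cartesian_product card_Diff_subset card_Pow)
  also have "card (?A D) = (\<Prod>c\<in>D. 2 ^ card c - 1)"
    using insert by (auto simp: disjoint_def)
  finally show ?case
    using insert by simp
qed

text \<open>Each diagonal is closed, and a closed set contains every diagonal that it meets.\<close>

lemma disjoint_diagonals:
  assumes \<pi>: "\<pi> permutes {1..k}"
  shows "disjoint (diagonals_to_avoid k \<pi>)"
proof (rule disjointI)
  fix c d assume cd: "c \<in> diagonals_to_avoid k \<pi>" "d \<in> diagonals_to_avoid k \<pi>" "c \<noteq> d"
  show "c \<inter> d = {}"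
  proof (rule ccontr)
    assume "c \<inter> d \<noteq> {}"
    then have "c \<subseteq> d" "d \<subseteq> c"
      using diagonals_connected[OF \<pi> _ corner_closed_diagonals[OF \<pi>]] cd by blast+
    then show False using cd by blast
  qed
qed

lemma finite_diagonals:
  assumes \<pi>: "\<pi> permutes {1..k}"
  shows "finite (diagonals_to_avoid k \<pi>)" "c \<in> diagonals_to_avoid k \<pi> \<Longrightarrow> finite c"
proof -
  have "diagonals_to_avoid k \<pi> \<subseteq> Pow ({0..k} \<times> {0..k})"
    using diagonals_subset[OF \<pi>] by blast
  then show "finite (diagonals_to_avoid k \<pi>)"
    by (rule finite_subset) simp
  show "c \<in> diagonals_to_avoid k \<pi> \<Longrightarrow> finite c"
    using diagonals_subset[OF \<pi>] finite_subset[of c "{0..k} \<times> {0..k}"] by blast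
qed

lemma sup_mesh_eq_prod_diagonals:
  assumes \<pi>: "\<pi> permutes {1..k}"
  shows "sup_mesh k \<pi> = (\<Prod>c\<in>diagonals_to_avoid k \<pi>. 2 ^ card c - 1)"
proof -
  have "{R. R \<subseteq> {0..k} \<times> {0..k} \<and> superfluous k \<pi> R} =
    {R. R \<subseteq> \<Union>(diagonals_to_avoid k \<pi>) \<and> (\<forall>c\<in>diagonals_to_avoid k \<pi>. \<not> c \<subseteq> R)}"
  proof (rule Collect_cong)
    fix R
    have "\<Union>(diagonals_to_avoid k \<pi>) \<subseteq> {0..k} \<times> {0..k}"
      by (rule Union_least) (rule diagonals_subset[OF \<pi>])
    then show "R \<subseteq> {0..k} \<times> {0..k} \<and> superfluous k \<pi> R \<longleftrightarrow>
      R \<subseteq> \<Union>(diagonals_to_avoid k \<pi>) \<and> (\<forall>c\<in>diagonals_to_avoid k \<pi>. \<not> c \<subseteq> R)"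
      using superfluous_iff_diagonals[OF \<pi>, of R] by (meson order_trans)
  qed
  then show ?thesis
    unfolding sup_mesh_def
    using card_no_block_subset[OF finite_diagonals(1)[OF \<pi>] finite_diagonals(2)[OF \<pi>]
        disjoint_diagonals[OF \<pi>]] by simp
qed

text \<open>Along a decreasing chain the sum of the coordinates is constant, whereas the first two
  squares of an increasing chain have sums differing by two.\<close>

lemma inc_dec_chains_disjoint: "inc_chains k \<pi> \<inter> dec_chains k \<pi> = {}"
proof -
  have False if inc: "c \<in> inc_chains k \<pi>" and dec: "c \<in> dec_chains k \<pi>" for c
  proof -
    obtain i j h where 1: "c = (\<lambda>x. (i + x, j + x)) ` {..<h}" "2 \<le> h"
      using inc by (auto simp: inc_chains_def)
    obtain i' j' h' where 2: "c = (\<lambda>x. (i' + x, j' - x)) ` {..<h'}" "decreasing_chain k \<pi> i' j' h'"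
      using dec by (auto simp: dec_chains_def)
    have "fst s + snd s = i' + j'" if "s \<in> c" for s
      using that 2 by (auto simp: decreasing_chain_def)
    moreover have "(i, j) \<in> c" "(i + 1, j + 1) \<in> c"
      using 1 by (auto intro: image_eqI[of _ _ 0] image_eqI[of _ _ 1])
    ultimately have "i + j = i' + j'" "(i + 1) + (j + 1) = i' + j'"
      by (metis fst_conv snd_conv)+
    then show False
      by linarith
  qed
  then show ?thesis by blast
qed

lemma inj_on_image_flip: "inj_on ((`) (flip k)) (inc_chains k f)"
proof (rule inj_onI)
  fix c d assume "c \<in> inc_chains k f" "d \<in> inc_chains k f" "flip k ` c = flip k ` d"
  then have "flip k ` flip k ` c = flip k ` flip k ` d" "c \<subseteq> {0..k} \<times> {0..k}" "d \<subseteq> {0..k} \<times> {0..k}"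
    using inc_chains_subset by (simp_all only:)
  then show "c = d"
    by (simp only: flip_image_flip_image)
qed

lemma card_flip_image: "c \<in> inc_chains k f \<Longrightarrow> card (flip k ` c) = card c"
  by (intro card_image inj_on_inverseI[of _ "flip k"] flip_flip) (use inc_chains_subset in blast)

lemma sup_mesh_eq_prod_ends:
  assumes \<pi>: "\<pi> permutes {1..k}"
  shows "sup_mesh k \<pi> = (\<Prod>e\<in>ends k \<pi>. 2 ^ Suc (run_length (succ_at k \<pi>) e) - 1) *
    (\<Prod>e\<in>ends k (rev_perm k \<circ> \<pi>). 2 ^ Suc (run_length (succ_at k (rev_perm k \<circ> \<pi>)) e) - 1)"
proof -
  have inc: "(\<Prod>c\<in>inc_chains k f. 2 ^ card c - 1) =
      (\<Prod>e\<in>ends k f. 2 ^ Suc (run_length (succ_at k f) e) - 1 :: nat)" if "f permutes {1..k}" for f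
    unfolding inc_chains_eq[OF that] prod.reindex[OF inj_on_inc_chain[OF that]]
    by (simp add: card_inc_chain)
  have "(\<Prod>c\<in>dec_chains k \<pi>. 2 ^ card c - 1) =
      (\<Prod>c\<in>inc_chains k (rev_perm k \<circ> \<pi>). 2 ^ card c - 1 :: nat)"
    unfolding dec_chains_eq[OF \<pi>] prod.reindex[OF inj_on_image_flip]
    by (intro prod.cong) (auto simp: card_flip_image)
  then show ?thesis
    using finite_diagonals(1)[OF \<pi>] inc[OF \<pi>] inc[OF rev_perm_comp_permutes[OF \<pi>]]
    unfolding sup_mesh_eq_prod_diagonals[OF \<pi>] diagonals_to_avoid_eq
    by (subst prod.union_disjoint) (auto simp: inc_dec_chains_disjoint)
qed

lemma card_diagonals_eq_ends:
  assumes \<pi>: "\<pi> permutes {1..k}"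
  shows "card (diagonals_to_avoid k \<pi>) = card (ends k \<pi>) + card (ends k (rev_perm k \<circ> \<pi>))"
proof -
  have inc: "card (inc_chains k f) = card (ends k f)" if "f permutes {1..k}" for f
    unfolding inc_chains_eq[OF that] by (rule card_image[OF inj_on_inc_chain[OF that]])
  have "card (dec_chains k \<pi>) = card (inc_chains k (rev_perm k \<circ> \<pi>))"
    unfolding dec_chains_eq[OF \<pi>] by (rule card_image[OF inj_on_image_flip])
  then show ?thesis
    using finite_diagonals(1)[OF \<pi>] inc[OF \<pi>] inc[OF rev_perm_comp_permutes[OF \<pi>]]
    unfolding diagonals_to_avoid_eq
    by (subst card_Un_disjoint) (auto simp: inc_dec_chains_disjoint)
qed

section \<open>Runs and weights\<close>

text \<open>The quotient of the factors \<open>2 ^ h - 1\<close> for \<open>h = Suc a\<close> and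
  \<open>h = a\<close>. Over the ranks \<open>1, ..., r\<close> these quotients telescope to
  \<open>2 ^ Suc r - 1\<close>, the factor of a run of \<open>r\<close> points.\<close>

definition weight :: "nat \<Rightarrow> real" where
  "weight a = (2 ^ Suc a - 1) / (2 ^ a - 1)"

lemma weight_eq: "1 \<le> a \<Longrightarrow> weight a = 2 + 1 / (2 ^ a - 1)"
proof -
  assume "1 \<le> a"
  then have "(1::real) < 2 ^ a"
    by simp
  then show ?thesis
    by (simp add: weight_def field_simps)
qed

lemma weight_less:
  assumes "1 \<le> a" "a < b"
  shows "weight b < weight a"
proof -
  have "(1::real) < 2 ^ a" "(2::real) ^ a < 2 ^ b"
    using assms by simp_all
  then have "1 / (2 ^ b - 1) < 1 / (2 ^ a - 1 :: real)"
    by (intro divide_strict_left_mono) auto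
  then show ?thesis
    using assms by (simp add: weight_eq)
qed

lemma weight_le: "1 \<le> a \<Longrightarrow> a \<le> b \<Longrightarrow> weight b \<le> weight a"
  using weight_less[of a b] by (cases "a = b") auto

lemma weight_pos: "1 \<le> a \<Longrightarrow> 0 < weight a"
proof -
  assume "1 \<le> a"
  then have "(1::real) < 2 ^ a"
    by simp
  then have "0 < 1 / (2 ^ a - 1 :: real)"
    by simp
  then show ?thesis
    using \<open>1 \<le> a\<close> by (simp only: weight_eq)
qed

lemma weight_small [simp]: "weight (Suc 0) = 3" "weight (Suc (Suc 0)) = 7 / 3" "weight (Suc (Suc (Suc 0))) = 15 / 7"
  by (simp_all add: weight_def)

lemma weight_le_3: "1 \<le> a \<Longrightarrow> weight a \<le> 3"
  using weight_le[of 1 a] by simp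

lemma prod_less_prod:
  fixes f g :: "'a \<Rightarrow> real"
  assumes A: "finite A" "a \<in> A" and le: "\<And>i. i \<in> A \<Longrightarrow> 0 < f i \<and> f i \<le> g i" and less: "f a < g a"
  shows "prod f A < prod g A"
proof -
  have "prod f (A - {a}) \<le> prod g (A - {a})"
    using le by (intro prod_mono) (auto intro: less_imp_le)
  moreover have "0 < prod f (A - {a})"
    using le by (intro prod_pos) auto
  ultimately have "f a * prod f (A - {a}) < g a * prod g (A - {a})"
    using less le[OF A(2)] by (intro mult_less_le_imp_less) auto
  then show ?thesis
    using prod.remove[OF A, of f] prod.remove[OF A, of g] by simp
qed

text \<open>The separate last factor belongs to the run reached at \<open>n\<close>, possibly
  unfinished. If the next index is joined, this factor is multiplied by a weight; otherwise it is
  final, and a new run begins with the factor \<open>weight 1 = 3\<close>.\<close>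

lemma prod_weight_run_length:
  assumes "\<not> P 0" "1 \<le> n"
  shows "(\<Prod>i\<in>{1..n}. weight (run_length P i)) =
    (\<Prod>e\<in>{e\<in>{1..<n}. \<not> P e}. 2 ^ Suc (run_length P e) - 1) * (2 ^ Suc (run_length P n) - 1)"
  using assms(2)
proof (induction n rule: nat_induct_at_least)
  case base
  then show ?case using assms(1) by (simp add: weight_def)
next
  case (Suc n)
  have "(1::real) < 2 ^ run_length P n"
    using run_length_pos[of n P] Suc.hyps by simp
  then have ne: "2 ^ Suc (run_length P n) - 1 \<noteq> (0::real)"
    by simp
  have "{e\<in>{1..<Suc n}. \<not> P e} =
      (if P n then {e\<in>{1..<n}. \<not> P e} else insert n {e\<in>{1..<n}. \<not> P e})"
    using Suc.hyps by (auto simp: less_Suc_eq)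
  then show ?case
    using Suc ne by (simp add: prod.nat_ivl_Suc' weight_def)
qed

lemma prod_ends:
  assumes "1 \<le> k"
  shows "real (\<Prod>e\<in>ends k f. 2 ^ Suc (run_length (succ_at k f) e) - 1) =
    (\<Prod>i\<in>{1..k}. weight (run_length (succ_at k f) i))"
proof -
  have "ends k f = insert k {e\<in>{1..<k}. \<not> succ_at k f e}"
    using assms by (auto simp: ends_def succ_at_def)
  then show ?thesis
    unfolding prod_weight_run_length[of "succ_at k f", OF not_succ_at_0 assms] by (simp add: of_nat_diff mult.commute)
qed

section \<open>Adjacent values in either direction\<close>

definition adj :: "nat \<Rightarrow> (nat \<Rightarrow> nat) \<Rightarrow> nat \<Rightarrow> bool" where
  "adj k \<pi> i \<longleftrightarrow> succ_at k \<pi> i \<or> succ_at k (rev_perm k \<circ> \<pi>) i"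

lemma not_adj_0 [simp]: "\<not> adj k \<pi> 0"
  by (simp add: adj_def)

lemma succ_at_rev_iff:
  assumes \<pi>: "\<pi> permutes {1..k}"
  shows "succ_at k (rev_perm k \<circ> \<pi>) i \<longleftrightarrow> 1 \<le> i \<and> i < k \<and> \<pi> i = Suc (\<pi> (Suc i))"
proof (cases "1 \<le> i \<and> i < k")
  case True
  then have "\<pi> i \<in> {1..k}" "\<pi> (Suc i) \<in> {1..k}"
    using permutes_in_image[OF \<pi>, of i] permutes_in_image[OF \<pi>, of "Suc i"] by auto
  then show ?thesis
    by (auto simp: succ_at_def rev_perm_def)
qed (auto simp: succ_at_def)

lemma adj_iff:
  assumes \<pi>: "\<pi> permutes {1..k}" and "1 \<le> i" "i < k"
  shows "adj k \<pi> i \<longleftrightarrow> \<bar>int (\<pi> i) - int (\<pi> (i + 1))\<bar> = 1"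
  using assms(2,3) unfolding adj_def succ_at_rev_iff[OF \<pi>] by (auto simp: succ_at_def)

text \<open>Steps of different kinds never follow each other, so a run of the joint predicate has
  steps of one kind only. Its ranks are those for that kind, and the ranks for the other kind are
  \<open>1\<close>.\<close>

lemma run_length_disj:
  assumes 0: "\<not> P 0" "\<not> Q 0" and "\<And>i. \<not> (P i \<and> Q i)" "\<And>i. P i \<Longrightarrow> \<not> Q (Suc i)"
    "\<And>i. Q i \<Longrightarrow> \<not> P (Suc i)" and "1 \<le> i"
  shows "run_length P i = 1 \<and> run_length (\<lambda>i. P i \<or> Q i) i = run_length Q i \<or>
    run_length Q i = 1 \<and> run_length (\<lambda>i. P i \<or> Q i) i = run_length P i"
  using \<open>1 \<le> i\<close>
proof (induction i rule: nat_induct_at_least)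
  case base
  then show ?case using 0 by simp
next
  case (Suc i)
  then obtain j where "i = Suc j"
    by (cases i) auto
  then show ?case
    using Suc assms(3)[of i] assms(4)[of j] assms(5)[of j] by auto
qed

lemma run_length_adj:
  assumes \<pi>: "\<pi> permutes {1..k}" and i: "1 \<le> i"
  shows "run_length (succ_at k \<pi>) i = 1 \<and>
      run_length (adj k \<pi>) i = run_length (succ_at k (rev_perm k \<circ> \<pi>)) i \<or>
    run_length (succ_at k (rev_perm k \<circ> \<pi>)) i = 1 \<and>
      run_length (adj k \<pi>) i = run_length (succ_at k \<pi>) i"
proof -
  let ?P = "succ_at k \<pi>" and ?Q = "succ_at k (rev_perm k \<circ> \<pi>)"
  \<comment> \<open>A rise by one followed by a fall by one, or conversely, would repeat a
    value.\<close>
  have inj: "\<pi> (Suc (Suc i)) \<noteq> \<pi> i" for i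
    using permutes_inj[OF \<pi>, THEN injD, of "Suc (Suc i)" i] by auto
  have adj: "adj k \<pi> = (\<lambda>i. ?P i \<or> ?Q i)"
    by (simp add: fun_eq_iff adj_def)
  show ?thesis
    unfolding adj
  proof (rule run_length_disj)
    show "?P i \<Longrightarrow> \<not> ?Q (Suc i)" "?Q i \<Longrightarrow> \<not> ?P (Suc i)" "\<not> (?P i \<and> ?Q i)" for i
      using inj[of i] unfolding succ_at_rev_iff[OF \<pi>] by (auto simp: succ_at_def)
  qed (use i in auto)
qed

text \<open>Of the two ranks at an index, one is \<open>1\<close> and contributes
  \<open>weight 1 = 3\<close>; the other is the rank for \<open>adj\<close>.\<close>

lemma sup_mesh_eq_weights:
  assumes \<pi>: "\<pi> permutes {1..k}" and k: "1 \<le> k"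
  shows "real (sup_mesh k \<pi>) = (\<Prod>i\<in>{1..k}. 3 * weight (run_length (adj k \<pi>) i))"
proof -
  have "weight (run_length (succ_at k \<pi>) i) * weight (run_length (succ_at k (rev_perm k \<circ> \<pi>)) i) =
    3 * weight (run_length (adj k \<pi>) i)" if i: "i \<in> {1..k}" for i
    using run_length_adj[OF \<pi>, of i] i by auto
  then show ?thesis
    unfolding sup_mesh_eq_prod_ends[OF \<pi>] of_nat_mult prod_ends[OF k] prod.distrib[symmetric]
    by (intro prod.cong) auto
qed

text \<open>Either direction would give \<open>k\<close> diagonals, one for each point; every
  adjacency merges two of them in its own direction.\<close>

lemma card_diagonals:
  assumes \<pi>: "\<pi> permutes {1..k}" and k: "1 \<le> k"
  shows "card (diagonals_to_avoid k \<pi>) + card {i\<in>{1..<k}. adj k \<pi> i} = 2 * k"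
proof -
  let ?P = "succ_at k \<pi>" and ?Q = "succ_at k (rev_perm k \<circ> \<pi>)"
  have "{i\<in>{1..<k}. adj k \<pi> i} = {i\<in>{1..<k}. ?P i} \<union> {i\<in>{1..<k}. ?Q i}"
    by (auto simp: adj_def)
  moreover have "{i\<in>{1..<k}. ?P i} \<inter> {i\<in>{1..<k}. ?Q i} = {}"
    unfolding succ_at_rev_iff[OF \<pi>] by (auto simp: succ_at_def)
  ultimately have "card {i\<in>{1..<k}. adj k \<pi> i} = card {i\<in>{1..<k}. ?P i} + card {i\<in>{1..<k}. ?Q i}"
    by (simp add: card_Un_disjoint)
  then show ?thesis
    using card_diagonals_eq_ends[OF \<pi>] card_ends[OF k, of \<pi>] card_ends[OF k, of "rev_perm k \<circ> \<pi>"]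
    by simp
qed

section \<open>Extremal values of the product of weights\<close>

lemma run_length_eq_self_iff:
  assumes "\<not> P 0" "1 \<le> n"
  shows "run_length P n = n \<longleftrightarrow> (\<forall>i\<in>{1..<n}. P i)"
  using assms(2)
proof (induction n rule: nat_induct_at_least)
  case base
  then show ?case using assms(1) by simp
next
  case (Suc n)
  then show ?case
    by (auto simp: less_Suc_eq Ball_def)
qed

text \<open>The rank of \<open>i\<close> is at most \<open>i\<close>, and weights decrease with the
  rank.\<close>

lemma sup_mesh_ge:
  assumes \<pi>: "\<pi> permutes {1..k}" and k: "1 \<le> k"
  shows "(\<Prod>i\<in>{1..k}. 3 * weight i) \<le> real (sup_mesh k \<pi>)"
    and "real (sup_mesh k \<pi>) = (\<Prod>i\<in>{1..k}. 3 * weight i) \<longleftrightarrow> (\<forall>i\<in>{1..<k}. adj k \<pi> i)"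
proof -
  let ?r = "run_length (adj k \<pi>)"
  have r: "0 < weight i \<and> weight i \<le> weight (?r i)" if "i \<in> {1..k}" for i
    using that weight_pos[of i] weight_le[of "?r i" i] run_length_pos[of i "adj k \<pi>"]
      run_length_le[of "adj k \<pi>" i] by auto
  show "(\<Prod>i\<in>{1..k}. 3 * weight i) \<le> real (sup_mesh k \<pi>)"
    unfolding sup_mesh_eq_weights[OF \<pi> k] using r by (intro prod_mono) (force intro: less_imp_le)
  show "real (sup_mesh k \<pi>) = (\<Prod>i\<in>{1..k}. 3 * weight i) \<longleftrightarrow> (\<forall>i\<in>{1..<k}. adj k \<pi> i)"
  proof
    assume all: "\<forall>i\<in>{1..<k}. adj k \<pi> i"
    have "?r i = i" if "i \<in> {1..k}" for i
      using that all run_length_eq_self_iff[of "adj k \<pi>" i] by auto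
    then show "real (sup_mesh k \<pi>) = (\<Prod>i\<in>{1..k}. 3 * weight i)"
      unfolding sup_mesh_eq_weights[OF \<pi> k] by simp
  next
    assume eq: "real (sup_mesh k \<pi>) = (\<Prod>i\<in>{1..k}. 3 * weight i)"
    show "\<forall>i\<in>{1..<k}. adj k \<pi> i"
    proof (rule ccontr)
      assume "\<not> (\<forall>i\<in>{1..<k}. adj k \<pi> i)"
      \<comment> \<open>One missing adjacency already keeps the rank of \<open>k\<close> below
        \<open>k\<close>, which makes the factor at \<open>k\<close> strictly larger.\<close>
      then have "?r k < k"
        using run_length_eq_self_iff[of "adj k \<pi>" k] run_length_le[of "adj k \<pi>" k] k by auto
      then have "weight k < weight (?r k)"
        using k run_length_pos[of k "adj k \<pi>"] by (intro weight_less) auto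
      then have "(\<Prod>i\<in>{1..k}. 3 * weight i) < (\<Prod>i\<in>{1..k}. 3 * weight (?r i))"
        using r k by (intro prod_less_prod[of _ k]) auto
      then show False
        using eq unfolding sup_mesh_eq_weights[OF \<pi> k] by simp
    qed
  qed
qed

text \<open>Ranks are at least \<open>1\<close>, so no weight exceeds \<open>weight 1 = 3\<close>;
  an adjacency at \<open>i\<close> gives \<open>Suc i\<close> a rank above \<open>1\<close> and
  hence a smaller factor.\<close>

lemma sup_mesh_le:
  assumes \<pi>: "\<pi> permutes {1..k}" and k: "1 \<le> k"
  shows "real (sup_mesh k \<pi>) \<le> 9 ^ k"
    and "real (sup_mesh k \<pi>) = 9 ^ k \<longleftrightarrow> (\<forall>i\<in>{1..<k}. \<not> adj k \<pi> i)"
proof -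
  let ?r = "run_length (adj k \<pi>)"
  have r: "0 < weight (?r i) \<and> weight (?r i) \<le> 3" if "i \<in> {1..k}" for i
    using that weight_pos[of "?r i"] weight_le_3[of "?r i"] run_length_pos[of i "adj k \<pi>"] by auto
  have nine: "(\<Prod>i\<in>{1..k}. 9) = (9 :: real) ^ k"
    by simp
  have "(\<Prod>i\<in>{1..k}. 3 * weight (?r i)) \<le> (\<Prod>i\<in>{1..k}. 9)"
    using r by (intro prod_mono) (force intro: less_imp_le)
  then show "real (sup_mesh k \<pi>) \<le> 9 ^ k"
    unfolding sup_mesh_eq_weights[OF \<pi> k] nine .
  show "real (sup_mesh k \<pi>) = 9 ^ k \<longleftrightarrow> (\<forall>i\<in>{1..<k}. \<not> adj k \<pi> i)"
  proof
    assume none: "\<forall>i\<in>{1..<k}. \<not> adj k \<pi> i"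
    have "?r i = 1" if i: "i \<in> {1..k}" for i
    proof -
      obtain j where j: "i = Suc j"
        using i by (cases i) auto
      then have "\<not> adj k \<pi> j"
        using none i by (cases "j = 0") auto
      then show ?thesis
        by (simp add: j)
    qed
    then show "real (sup_mesh k \<pi>) = 9 ^ k"
      unfolding sup_mesh_eq_weights[OF \<pi> k] by simp
  next
    assume eq: "real (sup_mesh k \<pi>) = 9 ^ k"
    show "\<forall>i\<in>{1..<k}. \<not> adj k \<pi> i"
    proof (rule ccontr)
      assume "\<not> (\<forall>i\<in>{1..<k}. \<not> adj k \<pi> i)"
      then obtain i where i: "1 \<le> i" "i < k" "adj k \<pi> i"
        by auto
      then have "1 < ?r (Suc i)"
        using run_length_pos[of i "adj k \<pi>"] by simp
      then have "weight (?r (Suc i)) < 3"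
        using weight_less[of 1 "?r (Suc i)"] by simp
      then have "(\<Prod>i\<in>{1..k}. 3 * weight (?r i)) < (\<Prod>i\<in>{1..k}. 9)"
        using r i by (intro prod_less_prod[of _ "Suc i"]) force+
      then show False
        using eq unfolding sup_mesh_eq_weights[OF \<pi> k] nine by simp
    qed
  qed
qed

text \<open>All steps being one, \<open>f\<close> is a shift on \<open>{1..k}\<close>; the bounds at
  both ends leave only the shift by zero.\<close>

lemma permutes_eq_id_if_succ:
  assumes f: "f permutes {1..k}" and all: "\<forall>i\<in>{1..<k}. succ_at k f i" and i: "i \<in> {1..k}"
  shows "f i = i"
proof -
  have k: "k \<in> {1..k}" "1 \<in> {1..k}"
    using i by auto
  have r: "run_length (succ_at k f) k = k"
    using run_length_eq_self_iff[of "succ_at k f" k] all k by auto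
  have *: "f i + (k - i) = f k" if "i \<in> {1..k}" for i
    using run_length_succ_at[OF k(1), of "k - i" f] r that by simp
  have "f k \<le> k" "1 \<le> f 1"
    using permutes_in_image[OF f] k by auto
  then have "f k = k"
    using *[OF k(2)] k by auto
  then show ?thesis
    using *[OF i] i by auto
qed

text \<open>A joint run has a single direction, so if it fills \<open>{1..k}\<close>, then
  \<open>\<pi>\<close> or its complement rises by steps of one.\<close>

lemma all_adj_iff:
  assumes \<pi>: "\<pi> permutes {1..k}" and k: "1 \<le> k"
  shows "(\<forall>i\<in>{1..<k}. adj k \<pi> i) \<longleftrightarrow> (\<forall>i\<in>{1..k}. \<pi> i = i) \<or> (\<forall>i\<in>{1..k}. \<pi> i = k + 1 - i)"
proof
  assume all: "\<forall>i\<in>{1..<k}. adj k \<pi> i"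
  then have "run_length (adj k \<pi>) k = k"
    using run_length_eq_self_iff[of "adj k \<pi>" k] k by simp
  then have "run_length (succ_at k \<pi>) k = k \<or> run_length (succ_at k (rev_perm k \<circ> \<pi>)) k = k"
    using run_length_adj[OF \<pi> k] by auto
  then have "(\<forall>i\<in>{1..<k}. succ_at k \<pi> i) \<or> (\<forall>i\<in>{1..<k}. succ_at k (rev_perm k \<circ> \<pi>) i)"
    using run_length_eq_self_iff[OF _ k, of "succ_at k \<pi>"]
      run_length_eq_self_iff[OF _ k, of "succ_at k (rev_perm k \<circ> \<pi>)"] by simp
  then show "(\<forall>i\<in>{1..k}. \<pi> i = i) \<or> (\<forall>i\<in>{1..k}. \<pi> i = k + 1 - i)"
  proof
    assume "\<forall>i\<in>{1..<k}. succ_at k \<pi> i"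
    then show ?thesis
      using permutes_eq_id_if_succ[OF \<pi>] by blast
  next
    assume *: "\<forall>i\<in>{1..<k}. succ_at k (rev_perm k \<circ> \<pi>) i"
    have "\<pi> i = k + 1 - i" if i: "i \<in> {1..k}" for i
    proof -
      have "rev_perm k (\<pi> i) = i"
        using permutes_eq_id_if_succ[OF rev_perm_comp_permutes[OF \<pi>] * i] by simp
      then have "\<pi> i = rev_perm k i"
        by (metis rev_perm_rev_perm)
      then show ?thesis
        using i by (simp add: rev_perm_def)
    qed
    then show ?thesis by blast
  qed
next
  assume "(\<forall>i\<in>{1..k}. \<pi> i = i) \<or> (\<forall>i\<in>{1..k}. \<pi> i = k + 1 - i)"
  then show "\<forall>i\<in>{1..<k}. adj k \<pi> i"
    using adj_iff[OF \<pi>] by auto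
qed

section \<open>Permutations without adjacencies, and the sizes lacking them\<close>

lemma exists_no_adj:
  assumes "1 \<le> k" "k \<noteq> 2" "k \<noteq> 3"
  obtains \<tau> where "\<tau> permutes {1..k}" "\<forall>i\<in>{1..<k}. \<not> adj k \<tau> i"
proof (cases "k = 1")
  case True
  then show ?thesis
    using that[OF permutes_id] by simp
next
  case False
  with assms have k: "4 \<le> k"
    by auto
  let ?m = "k div 2"
  \<comment> \<open>The even values in increasing order, then the odd ones. All steps are by two,
    except from \<open>2 * ?m\<close> down to \<open>1\<close>, a fall by at least three as
    \<open>4 \<le> k\<close>.\<close>
  define \<tau> where "\<tau> = (\<lambda>i. if i \<notin> {1..k} then i else if i \<le> ?m then 2 * i else 2 * (i - ?m) - 1)"
  have "inj_on \<tau> {1..k}"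
  proof (rule inj_onI)
    fix x y assume *: "x \<in> {1..k}" "y \<in> {1..k}" "\<tau> x = \<tau> y"
    show "x = y"
      using * unfolding \<tau>_def by (auto split: if_splits) presburger+
  qed
  moreover have "\<tau> ` {1..k} \<subseteq> {1..k}"
    by (auto simp: \<tau>_def)
  ultimately have "bij_betw \<tau> {1..k} {1..k}"
    by (simp add: bij_betw_def endo_inj_surj)
  then have \<tau>: "\<tau> permutes {1..k}"
    by (rule bij_imp_permutes) (simp add: \<tau>_def)
  have "\<not> adj k \<tau> i" if i: "i \<in> {1..<k}" for i
  proof -
    consider "i < ?m" | "i = ?m" | "?m < i"
      by linarith
    then have "\<bar>int (\<tau> i) - int (\<tau> (i + 1))\<bar> \<noteq> 1"
    proof cases
      case 1
      then show ?thesis using i by (simp add: \<tau>_def)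
    next
      case 2
      then show ?thesis using i k by (auto simp: \<tau>_def)
    next
      case 3
      then show ?thesis using i by (auto simp: \<tau>_def)
    qed
    then show ?thesis
      using adj_iff[OF \<tau>, of i] i by auto
  qed
  then show ?thesis
    using that \<tau> by blast
qed

text \<open>Here adjacencies cannot be avoided. Ranks \<open>1\<close>, \<open>2\<close>,
  \<open>3\<close> contribute the factors \<open>9\<close>, \<open>7\<close>, \<open>45 / 7\<close>,
  so that \<open>63 = 9 * 7\<close>, \<open>567 = 9 * 9 * 7\<close> and
  \<open>405 = 9 * 7 * (45 / 7)\<close>; each adjacency takes one from the \<open>2 * k\<close>
  diagonals.\<close>

lemma sup_mesh_and_card_diagonals_small:
  assumes \<pi>: "\<pi> permutes {1..k}" and k: "k = 2 \<or> k = 3"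
  shows "k = 2 \<and> sup_mesh k \<pi> = 63 \<and> card (diagonals_to_avoid k \<pi>) = 3 \<or>
    k = 3 \<and> (sup_mesh k \<pi> = 567 \<and> card (diagonals_to_avoid k \<pi>) = 5 \<or>
      sup_mesh k \<pi> = 405 \<and> card (diagonals_to_avoid k \<pi>) = 4)"
proof -
  have k1: "1 \<le> k"
    using k by auto
  have Suc_2: "Suc 2 = 3"
    by simp
  have r: "run_length P 2 = (if P 1 then Suc (run_length P 1) else 1)"
    "run_length P 3 = (if P 2 then Suc (run_length P 2) else 1)" for P
    using run_length.simps(2)[of P 1] run_length.simps(2)[of P 2] by (simp_all only: Suc_1 Suc_2)
  have inj: "\<pi> 1 \<noteq> \<pi> 2" "\<pi> 1 \<noteq> \<pi> 3" "\<pi> 2 \<noteq> \<pi> 3"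
    by (simp_all add: inj_eq[OF permutes_inj[OF \<pi>]])
  have sets: "{1..2::nat} = {1, 2}" "{1..3::nat} = {1, 2, 3}" "{1..<2::nat} = {1}" "{1..<3::nat} = {1, 2}"
    by auto
  show ?thesis
  proof (cases "k = 2")
    case True
    have "\<pi> 1 \<in> {1..2}" "\<pi> 2 \<in> {1..2}"
      using permutes_in_image[OF \<pi>] unfolding True by simp_all
    then have "\<bar>int (\<pi> 1) - int (\<pi> 2)\<bar> = 1"
      using inj by auto
    then have adj: "adj 2 \<pi> 1"
      using adj_iff[OF \<pi>, of 1] True by (simp add: one_add_one del: One_nat_def)
    then have "{i\<in>{1..<2}. adj 2 \<pi> i} = {1}"
      unfolding sets by auto
    then have "card (diagonals_to_avoid 2 \<pi>) = 3"
      using card_diagonals[OF \<pi> k1] True by simp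
    moreover have "real (sup_mesh 2 \<pi>) = 63"
      using sup_mesh_eq_weights[OF \<pi> k1] adj unfolding True sets by (simp add: r)
    ultimately show ?thesis
      using True by simp
  next
    case False
    with k have k3: "k = 3" by simp
    have "\<pi> 1 \<in> {1..3}" "\<pi> 2 \<in> {1..3}" "\<pi> 3 \<in> {1..3}"
      using permutes_in_image[OF \<pi>] unfolding k3 by simp_all
    then have "\<bar>int (\<pi> 1) - int (\<pi> 2)\<bar> = 1 \<or> \<bar>int (\<pi> 2) - int (\<pi> 3)\<bar> = 1"
      using inj unfolding atLeastAtMost_iff by linarith
    moreover have "adj 3 \<pi> 1 \<longleftrightarrow> \<bar>int (\<pi> 1) - int (\<pi> 2)\<bar> = 1"
      "adj 3 \<pi> 2 \<longleftrightarrow> \<bar>int (\<pi> 2) - int (\<pi> 3)\<bar> = 1"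
      using adj_iff[OF \<pi>, of 1] adj_iff[OF \<pi>, of 2] k3
      by (simp_all add: one_add_one del: One_nat_def)
    ultimately have adj: "adj 3 \<pi> 1 \<or> adj 3 \<pi> 2"
      by blast
    have "card {i\<in>{1..<3}. adj 3 \<pi> i} = (if adj 3 \<pi> 1 then 1 else 0) + (if adj 3 \<pi> 2 then 1 else 0)"
    proof -
      have "{i\<in>{1..<3}. adj 3 \<pi> i} = (if adj 3 \<pi> 1 then {1} else {}) \<union> (if adj 3 \<pi> 2 then {2} else {})"
        unfolding sets by auto
      then show ?thesis
        by simp
    qed
    then have "card (diagonals_to_avoid 3 \<pi>) = (if adj 3 \<pi> 1 \<and> adj 3 \<pi> 2 then 4 else 5)"
      using card_diagonals[OF \<pi> k1] adj unfolding k3 by (simp split: if_splits)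
    moreover have "real (sup_mesh 3 \<pi>) = (if adj 3 \<pi> 1 \<and> adj 3 \<pi> 2 then 405 else 567)"
      using sup_mesh_eq_weights[OF \<pi> k1] adj unfolding k3 sets
      by (auto simp: r)
    ultimately show ?thesis
      using k3 by (simp split: if_splits)
  qed
qed

lemma sup_mesh_le_iff_small:
  assumes "\<pi> permutes {1..k}" "\<tau> permutes {1..k}" "k = 2 \<or> k = 3"
  shows "sup_mesh k \<tau> \<le> sup_mesh k \<pi> \<longleftrightarrow>
    card (diagonals_to_avoid k \<tau>) \<le> card (diagonals_to_avoid k \<pi>)"
  using sup_mesh_and_card_diagonals_small[OF assms(1,3)] sup_mesh_and_card_diagonals_small[OF assms(2,3)] by auto

text \<open>In sizes \<open>2\<close> and \<open>3\<close> every permutation has an adjacency, so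
  the criterion by differences is restricted to the other sizes. The last equivalence, which
  compares numbers of diagonals instead, covers all sizes.\<close>

theorem corollary5p4:
  fixes k :: nat and \<pi> :: "nat \<Rightarrow> nat"
  assumes "1 \<le> k" and "\<pi> permutes {1..k}"
  shows
    "(((\<forall>\<tau>. \<tau> permutes {1..k} \<longrightarrow> sup_mesh k \<pi> \<le> sup_mesh k \<tau>) \<longleftrightarrow>
        (\<forall>i. 1 \<le> i \<and> i < k \<longrightarrow> \<bar>int (\<pi> i) - int (\<pi> (i + 1))\<bar> = 1)) \<and>
      ((\<forall>i. 1 \<le> i \<and> i < k \<longrightarrow> \<bar>int (\<pi> i) - int (\<pi> (i + 1))\<bar> = 1) \<longleftrightarrow>
        (\<forall>i\<in>{1..k}. \<pi> i = i) \<or> (\<forall>i\<in>{1..k}. \<pi> i = k + 1 - i)))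
     \<and>
     ((k \<noteq> 2 \<and> k \<noteq> 3 \<longrightarrow>
        ((\<forall>\<tau>. \<tau> permutes {1..k} \<longrightarrow> sup_mesh k \<tau> \<le> sup_mesh k \<pi>) \<longleftrightarrow>
          (\<forall>i. 1 \<le> i \<and> i < k \<longrightarrow> \<bar>int (\<pi> i) - int (\<pi> (i + 1))\<bar> \<noteq> 1))) \<and>
      ((\<forall>i. 1 \<le> i \<and> i < k \<longrightarrow> \<bar>int (\<pi> i) - int (\<pi> (i + 1))\<bar> \<noteq> 1) \<longleftrightarrow>
        card (diagonals_to_avoid k \<pi>) = 2 * k) \<and>
      (\<forall>\<tau>. \<tau> permutes {1..k} \<longrightarrow> card (diagonals_to_avoid k \<tau>) \<le> 2 * k) \<and>
      ((\<forall>\<tau>. \<tau> permutes {1..k} \<longrightarrow> sup_mesh k \<tau> \<le> sup_mesh k \<pi>) \<longleftrightarrow>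
        (\<forall>\<tau>. \<tau> permutes {1..k} \<longrightarrow>
           card (diagonals_to_avoid k \<tau>) \<le> card (diagonals_to_avoid k \<pi>))))"
proof -
  note k = assms(1) and \<pi> = assms(2)
  have all: "(\<forall>i. 1 \<le> i \<and> i < k \<longrightarrow> \<bar>int (\<pi> i) - int (\<pi> (i + 1))\<bar> = 1) \<longleftrightarrow> (\<forall>i\<in>{1..<k}. adj k \<pi> i)"
    and none: "(\<forall>i. 1 \<le> i \<and> i < k \<longrightarrow> \<bar>int (\<pi> i) - int (\<pi> (i + 1))\<bar> \<noteq> 1) \<longleftrightarrow> (\<forall>i\<in>{1..<k}. \<not> adj k \<pi> i)"
    using adj_iff[OF \<pi>] by auto
  have min: "(\<forall>\<tau>. \<tau> permutes {1..k} \<longrightarrow> sup_mesh k \<pi> \<le> sup_mesh k \<tau>) \<longleftrightarrow> (\<forall>i\<in>{1..<k}. adj k \<pi> i)"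
  proof
    assume "\<forall>\<tau>. \<tau> permutes {1..k} \<longrightarrow> sup_mesh k \<pi> \<le> sup_mesh k \<tau>"
    \<comment> \<open>The identity attains the lower bound, so a minimiser attains it as
      well.\<close>
    then have "sup_mesh k \<pi> \<le> sup_mesh k id"
      using permutes_id by blast
    moreover have "\<forall>i\<in>{1..<k}. adj k id i"
      using all_adj_iff[OF permutes_id k] by simp
    then have "real (sup_mesh k id) = (\<Prod>i\<in>{1..k}. 3 * weight i)"
      using sup_mesh_ge(2)[OF permutes_id k] by blast
    ultimately have "real (sup_mesh k \<pi>) = (\<Prod>i\<in>{1..k}. 3 * weight i)"
      using sup_mesh_ge(1)[OF \<pi> k] by linarith
    then show "\<forall>i\<in>{1..<k}. adj k \<pi> i"
      using sup_mesh_ge(2)[OF \<pi> k] by blast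
  next
    assume "\<forall>i\<in>{1..<k}. adj k \<pi> i"
    then have "real (sup_mesh k \<pi>) = (\<Prod>i\<in>{1..k}. 3 * weight i)"
      using sup_mesh_ge(2)[OF \<pi> k] by blast
    then show "\<forall>\<tau>. \<tau> permutes {1..k} \<longrightarrow> sup_mesh k \<pi> \<le> sup_mesh k \<tau>"
      using sup_mesh_ge(1)[OF _ k] by (metis of_nat_le_iff)
  qed
  have card: "card (diagonals_to_avoid k \<tau>) \<le> 2 * k"
    "card (diagonals_to_avoid k \<tau>) = 2 * k \<longleftrightarrow> (\<forall>i\<in>{1..<k}. \<not> adj k \<tau> i)" if "\<tau> permutes {1..k}" for \<tau>
  proof -
    show "card (diagonals_to_avoid k \<tau>) \<le> 2 * k"
      using card_diagonals[OF that k] by simp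
    have "card (diagonals_to_avoid k \<tau>) = 2 * k \<longleftrightarrow> card {i\<in>{1..<k}. adj k \<tau> i} = 0"
      using card_diagonals[OF that k] by linarith
    then show "card (diagonals_to_avoid k \<tau>) = 2 * k \<longleftrightarrow> (\<forall>i\<in>{1..<k}. \<not> adj k \<tau> i)"
      by auto
  qed
  have max: "(\<forall>\<tau>. \<tau> permutes {1..k} \<longrightarrow> sup_mesh k \<tau> \<le> sup_mesh k \<pi>) \<longleftrightarrow> (\<forall>i\<in>{1..<k}. \<not> adj k \<pi> i)"
    "(\<forall>\<tau>. \<tau> permutes {1..k} \<longrightarrow> card (diagonals_to_avoid k \<tau>) \<le> card (diagonals_to_avoid k \<pi>))
      \<longleftrightarrow> (\<forall>i\<in>{1..<k}. \<not> adj k \<pi> i)" if k23: "k \<noteq> 2" "k \<noteq> 3"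
  proof -
    \<comment> \<open>This permutation attains both upper bounds, \<open>9 ^ k\<close> and
      \<open>2 * k\<close>, so the maximisers of either quantity are the permutations attaining its
      bound.\<close>
    obtain \<tau> where \<tau>: "\<tau> permutes {1..k}" "\<forall>i\<in>{1..<k}. \<not> adj k \<tau> i"
      using exists_no_adj[OF k k23] by blast
    have le: "sup_mesh k \<rho> \<le> 9 ^ k" "sup_mesh k \<rho> = 9 ^ k \<longleftrightarrow> (\<forall>i\<in>{1..<k}. \<not> adj k \<rho> i)"
      if "\<rho> permutes {1..k}" for \<rho>
      using sup_mesh_le[OF that k] by (metis of_nat_le_iff of_nat_eq_iff of_nat_power of_nat_numeral)+
    show "(\<forall>\<tau>. \<tau> permutes {1..k} \<longrightarrow> sup_mesh k \<tau> \<le> sup_mesh k \<pi>) \<longleftrightarrow> (\<forall>i\<in>{1..<k}. \<not> adj k \<pi> i)"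
      using le \<tau> \<pi> by (metis le_antisym)
    show "(\<forall>\<tau>. \<tau> permutes {1..k} \<longrightarrow> card (diagonals_to_avoid k \<tau>) \<le> card (diagonals_to_avoid k \<pi>))
      \<longleftrightarrow> (\<forall>i\<in>{1..<k}. \<not> adj k \<pi> i)"
      using card \<tau> \<pi> by (metis le_antisym)
  qed
  have "(\<forall>\<tau>. \<tau> permutes {1..k} \<longrightarrow> sup_mesh k \<tau> \<le> sup_mesh k \<pi>) \<longleftrightarrow>
    (\<forall>\<tau>. \<tau> permutes {1..k} \<longrightarrow> card (diagonals_to_avoid k \<tau>) \<le> card (diagonals_to_avoid k \<pi>))"
  proof (cases "k = 2 \<or> k = 3")
    case True
    then show ?thesis
      using sup_mesh_le_iff_small[OF \<pi>] by blast
  next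
    case False
    then show ?thesis
      using max by simp
  qed
  then show ?thesis
    unfolding all none using min all_adj_iff[OF \<pi> k] max(1) card card(2)[OF \<pi>] by blast
qed

end
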